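(* Suppose that the Verblunsky coefficients satisfy $\lim_{n\to\infty}|\alpha_n|^{1/n}=b$ with $b<1$. Let $z_0$ obey $|z_0|>b$ and $D(1/\bar z_0)^{-1}=0$ (i.e., $z_0$ is a Nevai-Totik zero). For $n$ large, let $z_n$ be zeros of $\varphi_n(z)$ near $z_0$ (that is, $\varphi_n(z_n)=0$ and $z_n\to z_0$). Then for some $\varepsilon>0$ and all $n$ large, $$|z_n-z_0|\le e^{-\varepsilon n}.$$
   Context: $\mathbb{D}=\{|z|<1\}$. For a probability measure $d\mu=w(\theta)\frac{d\theta}{2\pi}+d\mu_s$ on $\partial\mathbb{D}$ not supported on a finite set, $\Phi_n$ are the monic orthogonal polynomials, $\varphi_n=\Phi_n/\|\Phi_n\|_{L^2(d\mu)}$ the orthonormal ones, and the Verblunsky coefficients are $\alpha_n=-\overline{\Phi_{n+1}(0)}$. The Szegő function is $D(z)=\exp\bigl(\int\frac{e^{i\theta}+z}{e^{i\theta}-z}\log w(\theta)\frac{d\theta}{4\pi}\bigr)$, $z\in\mathbb{D}$, and $D(z)^{-1}$ means $1/D(z)$. When $\lim|\alpha_n|^{1/n}=b<1$, $D^{-1}$ has an analytic continuation to $\{|z|<b^{-1}\}$, again denoted $D(z)^{-1}$, nonvanishing on $\overline{\mathbb{D}}$. *)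

theory Defs
  imports
    "HOL-Probability.Probability"
    "HOL-Complex_Analysis.Complex_Analysis"
    "HOL-Computational_Algebra.Polynomial"
begin

text \<open>Probability measures on the unit circle, viewed as Borel measures on \<^typ>\<open>complex\<close>
  that give full mass to the circle and are not supported on a finite set.\<close>

definition nontrivial_circle_prob :: "complex measure \<Rightarrow> bool" where
  "nontrivial_circle_prob \<mu> \<longleftrightarrow>
     prob_space \<mu> \<and> sets \<mu> = sets borel \<and> (AE z in \<mu>. cmod z = 1) \<and>
     (\<forall>F. finite F \<longrightarrow> \<not> (AE z in \<mu>. z \<in> F))"

text \<open>The measure $d\theta/2\pi$ on one period.\<close>

definition normalized_dtheta :: "real measure" where
  "normalized_dtheta = uniform_measure lborel {0..<2 * pi}"

text \<open>The Lebesgue decomposition $d\mu = w(\theta)\,d\theta/2\pi + d\mu_s$, transported to the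
  circle by \<^const>\<open>cis\<close>; the last conjunct says that \<open>\<mu>s\<close> is singular to arc length.\<close>

definition circle_lebesgue_decomposition ::
    "complex measure \<Rightarrow> (real \<Rightarrow> real) \<Rightarrow> complex measure \<Rightarrow> bool" where
  "circle_lebesgue_decomposition \<mu> w \<mu>s \<longleftrightarrow>
     w \<in> borel_measurable borel \<and> (\<forall>\<theta>. 0 \<le> w \<theta>) \<and> sets \<mu>s = sets borel \<and>
     (\<forall>A\<in>sets borel. emeasure \<mu> A =
        emeasure (distr (density normalized_dtheta (\<lambda>\<theta>. ennreal (w \<theta>))) borel cis) A
        + emeasure \<mu>s A) \<and>
     (\<exists>N\<in>sets borel. emeasure (distr normalized_dtheta borel cis) N = 0 \<and>
        emeasure \<mu>s (- N) = 0)"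

text \<open>The defining conditions determine the polynomial uniquely when \<open>\<mu>\<close> is not supported
  on a finite set.\<close>

definition monic_opuc :: "complex measure \<Rightarrow> nat \<Rightarrow> complex poly" where
  "monic_opuc \<mu> n = (THE p. degree p = n \<and> lead_coeff p = 1 \<and>
     (\<forall>j<n. (\<integral>z. cnj (z ^ j) * poly p z \<partial>\<mu>) = 0))"

definition orthonormal_opuc :: "complex measure \<Rightarrow> nat \<Rightarrow> complex poly" where
  "orthonormal_opuc \<mu> n =
     smult (complex_of_real (1 / sqrt (\<integral>z. (cmod (poly (monic_opuc \<mu> n) z))\<^sup>2 \<partial>\<mu>)))
       (monic_opuc \<mu> n)"

definition verblunsky :: "complex measure \<Rightarrow> nat \<Rightarrow> complex" where
  "verblunsky \<mu> n = - cnj (poly (monic_opuc \<mu> (Suc n)) 0)"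

text \<open>Meaningful only when $\log w$ is integrable (so that $w > 0$ almost everywhere);
  this is automatic when the Verblunsky coefficients decay exponentially, by the theorem of
  Szego.\<close>

definition szego_function :: "(real \<Rightarrow> real) \<Rightarrow> complex \<Rightarrow> complex" where
  "szego_function w z =
     exp ((LBINT \<theta>:{0..<2 * pi}. (cis \<theta> + z) / (cis \<theta> - z) * complex_of_real (ln (w \<theta>)))
          / complex_of_real (4 * pi))"

text \<open>The disk $|z| < b^{-1}$, which is the whole plane for \<open>b = 0\<close>.\<close>

definition inverse_disk :: "real \<Rightarrow> complex set" where
  "inverse_disk b = {z. b * cmod z < 1}"

text \<open>The analytic continuation of $D^{-1}$ from the unit disk to $|z| < b^{-1}$. For
  \<open>0 \<le> b < 1\<close> it is unique on that disk by the identity theorem; the values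
  outside the disk are unspecified.\<close>

definition szego_inverse :: "(real \<Rightarrow> real) \<Rightarrow> real \<Rightarrow> complex \<Rightarrow> complex" where
  "szego_inverse w b = (SOME G. G holomorphic_on inverse_disk b \<and>
     (\<forall>z\<in>ball 0 1. G z = 1 / szego_function w z))"

end

theory Submission
  imports Defs
begin

text \<open>
  Let \<open>\<Phi>r n\<close> be the reversed polynomial $\Phi_n^*$. By the Szego recursion
  $\Phi_{n+1}^* - \Phi_n^* = -\alpha_n z \Phi_n$, the $\Phi_n^*$ converge with geometric rate,
  locally uniformly on $|z| < b^{-1}$, to a function $G$ that has no zeros on the closed unit disk.
  Since $\Phi_n^*$ is orthogonal to $z, \dots, z^n$, all nonconstant moments of $|G|^2 d\mu$
  vanish, so $|G|^2 d\mu = \kappa\, d\theta/2\pi$; hence $w = \kappa/|G|^2$ almost everywhere,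
  and the Schwarz formula for $\log G$ gives $D^{-1} = G/\sqrt{\kappa}$. A zero $z_n$ of
  $\varphi_n$ near $z_0$ gives a zero $u_n = 1/\bar z_n$ of $\Phi_n^*$ near $u = 1/\bar z_0$, so
  $|G(u_n)|$ is exponentially small, while $|G(u_n)| \ge c |u_n - u|^k$ with $k$ the order of the
  zero of $G$ at $u$.
\<close>

subsection \<open>Measures on the unit circle and their moments\<close>

text \<open>Nothing is given about \<open>w\<close> beyond the Lebesgue decomposition: neither
  control of its logarithm nor existence of the continuation of 1/D is available in advance, and
  both have to come out of \<open>G\<close>. This is why the measure is recovered from its moments:
  \<open>w\<close> then agrees almost everywhere with a continuous positive function, the integral
  defining D can be evaluated, and \<open>G\<close> itself supplies the continuation. The geometric
  rate must be uniform on a disk, since it is used at the moving points u_n: there the reversed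
  polynomial vanishes, so |G(u_n)| is at most the approximation error. The condition |z_0| > b is
  what places u in the disk of convergence. The order k is finite because G(0) = 1 and the disk is
  connected; it costs a factor 1/k in the exponent, and the passage from u_n - u back to z_n - z_0
  costs only a bounded factor.\<close>

lemma borel_measurable_poly [measurable]: "poly (p :: complex poly) \<in> borel_measurable borel"
  by (intro borel_measurable_continuous_onI continuous_intros)

lemma borel_measurable_cnj [measurable]: "cnj \<in> borel_measurable borel"
  by (intro borel_measurable_continuous_onI continuous_intros)

lemma cnj_mult_self_circle: "cmod z = 1 \<Longrightarrow> cnj z * z = 1"
  by (metis complex_norm_square mult.commute of_real_1 power_one)

locale circle_measure = finite_measure M for M :: "complex measure" +
  assumes sets_circle_measure [measurable_cong, simp]: "sets M = sets borel"
    and AE_circle: "AE z in M. cmod z = 1"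
begin

lemma space_circle_measure [simp]: "space M = UNIV"
  using sets_eq_imp_space_eq[OF sets_circle_measure] by simp

lemma integrable_bounded_circle:
  fixes f :: "complex \<Rightarrow> 'b :: {banach, second_countable_topology}"
  assumes "f \<in> borel_measurable borel" "\<And>z. cmod z = 1 \<Longrightarrow> norm (f z) \<le> B"
  shows "integrable M f"
proof (rule integrable_const_bound)
  show "AE z in M. norm (f z) \<le> B"
    using AE_circle assms(2) by auto
qed (use assms(1) in measurable)

lemma integrable_continuous:
  fixes f :: "complex \<Rightarrow> 'b :: {banach, second_countable_topology}"
  assumes "continuous_on UNIV f"
  shows "integrable M f"
proof -
  have "compact (f ` sphere 0 1)"
    by (intro compact_continuous_image continuous_on_subset[OF assms]) auto
  then obtain B where "\<And>z. z \<in> sphere 0 1 \<Longrightarrow> norm (f z) \<le> B"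
    by (meson bounded_iff compact_imp_bounded imageI)
  thus ?thesis
    by (intro integrable_bounded_circle[of f B] borel_measurable_continuous_onI assms) auto
qed

end

text \<open>On the circle \<open>cnj z\<close> is 1/z, so Re z and Im z, and with them all real
  polynomials in both, are Laurent polynomials; the factor \<open>cnj z ^ n\<close> carries the
  negative powers.\<close>

lemma real_polynomial_function_circle:
  assumes "real_polynomial_function f"
  shows "\<exists>n p. \<forall>z. cmod z = 1 \<longrightarrow> complex_of_real (f z) = cnj z ^ n * poly p z"
  using assms
proof (induction rule: real_polynomial_function.induct)
  case (linear f)
  interpret bounded_linear f by fact
  \<comment> \<open>The coefficients come from Re z = (z + cnj z)/2 and Im z = (z - cnj z)/(2i),
    which give f z = A z + B cnj z.\<close>
  define A where "A = (complex_of_real (f 1) - \<i> * f \<i>) / 2"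
  define B where "B = (complex_of_real (f 1) + \<i> * f \<i>) / 2"
  have "complex_of_real (f z) = cnj z ^ 1 * poly [:B, 0, A:] z" if "cmod z = 1" for z
  proof -
    have "z = Re z *\<^sub>R 1 + Im z *\<^sub>R \<i>"
      by (simp add: complex_eq_iff)
    hence "f z = Re z * f 1 + Im z * f \<i>"
      by (metis add scaleR real_scaleR_def)
    moreover have "A * z + B * cnj z = complex_of_real (Re z * f 1 + Im z * f \<i>)"
      by (simp add: A_def B_def complex_eq_iff field_simps)
    moreover have "cnj z ^ 1 * poly [:B, 0, A:] z = A * z * (cnj z * z) + B * cnj z"
      by (simp add: algebra_simps)
    ultimately show ?thesis
      by (simp only: cnj_mult_self_circle[OF that] mult_1_right)
  qed
  thus ?case by blast
next
  case (const c)
  have "\<forall>z. cmod z = 1 \<longrightarrow> complex_of_real c = cnj z ^ 0 * poly [:complex_of_real c:] z"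
    by simp
  thus ?case by blast
next
  case (add f g)
  then obtain n p m q where
    fg: "\<And>z. cmod z = 1 \<Longrightarrow> complex_of_real (f z) = cnj z ^ n * poly p z"
        "\<And>z. cmod z = 1 \<Longrightarrow> complex_of_real (g z) = cnj z ^ m * poly q z"
    by blast
  have "complex_of_real (f z + g z) = cnj z ^ (n + m) * poly (monom 1 m * p + monom 1 n * q) z"
    if "cmod z = 1" for z
  proof -
    have "cnj z ^ (n + m) * poly (monom 1 m * p + monom 1 n * q) z =
            cnj z ^ n * poly p z * (cnj z * z) ^ m + cnj z ^ m * poly q z * (cnj z * z) ^ n"
      by (simp add: poly_monom power_add power_mult_distrib algebra_simps)
    thus ?thesis
      using fg[OF that] by (simp add: cnj_mult_self_circle[OF that])
  qed
  thus ?case by blast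
next
  case (mult f g)
  then obtain n p m q where
    fg: "\<And>z. cmod z = 1 \<Longrightarrow> complex_of_real (f z) = cnj z ^ n * poly p z"
        "\<And>z. cmod z = 1 \<Longrightarrow> complex_of_real (g z) = cnj z ^ m * poly q z"
    by blast
  have "complex_of_real (f z * g z) = cnj z ^ (n + m) * poly (p * q) z" if "cmod z = 1" for z
    using fg[OF that] by (simp add: power_add)
  thus ?case by blast
qed

lemma cnj_power_mult_power_circle:
  assumes "cmod z = 1"
  shows "cnj z ^ n * z ^ k = (if n \<le> k then z ^ (k - n) else cnj (z ^ (n - k)))"
proof (cases "n \<le> k")
  case True
  hence "z ^ k = z ^ n * z ^ (k - n)" by (simp flip: power_add)
  hence "cnj z ^ n * z ^ k = (cnj z * z) ^ n * z ^ (k - n)"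
    by (simp add: power_mult_distrib mult.assoc)
  thus ?thesis using True by (simp add: cnj_mult_self_circle[OF assms])
next
  case False
  hence "cnj z ^ n = cnj z ^ (n - k) * cnj z ^ k" by (simp flip: power_add)
  hence "cnj z ^ n * z ^ k = cnj z ^ (n - k) * (cnj z * z) ^ k"
    by (simp add: power_mult_distrib mult.assoc)
  thus ?thesis using False by (simp add: cnj_mult_self_circle[OF assms])
qed

text \<open>Negative moments are conjugates of positive ones, so the moments of nonnegative order
  determine the integrals of all Laurent polynomials.\<close>

lemma (in circle_measure) integral_cnj_power_mult_power:
  "(\<integral>z. cnj z ^ n * z ^ k \<partial>M) =
     (if n \<le> k then (\<integral>z. z ^ (k - n) \<partial>M) else cnj (\<integral>z. z ^ (n - k) \<partial>M))"
proof -
  have "(\<integral>z. cnj z ^ n * z ^ k \<partial>M) = (\<integral>z. (if n \<le> k then z ^ (k - n) else cnj (z ^ (n - k))) \<partial>M)"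
  proof (rule integral_cong_AE)
    show "AE z in M. cnj z ^ n * z ^ k = (if n \<le> k then z ^ (k - n) else cnj (z ^ (n - k)))"
      using AE_circle by eventually_elim (rule cnj_power_mult_power_circle)
  qed measurable
  also have "\<dots> = (if n \<le> k then (\<integral>z. z ^ (k - n) \<partial>M) else cnj (\<integral>z. z ^ (n - k) \<partial>M))"
  proof (cases "n \<le> k")
    case False
    thus ?thesis
      by (simp only: if_False) (rule Bochner_Integration.integral_cnj)
  qed simp
  finally show ?thesis .
qed

text \<open>Stone-Weierstrass: real polynomials are uniformly dense in the continuous functions on
  the compact circle, and their integrals are finite combinations of moments.\<close>

lemma circle_measure_integral_eqI:
  fixes f :: "complex \<Rightarrow> real"
  assumes "circle_measure M" "circle_measure N"
    and moments: "\<And>k. (\<integral>z. z ^ k \<partial>M) = (\<integral>z. z ^ k \<partial>N)"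
    and f: "continuous_on UNIV f"
  shows "(\<integral>z. f z \<partial>M) = (\<integral>z. f z \<partial>N)"
proof -
  interpret M: circle_measure M by fact
  interpret N: circle_measure N by fact
  have polyfun: "(\<integral>z. g z \<partial>M) = (\<integral>z. g z \<partial>N)" if g: "real_polynomial_function g" for g
  proof -
    obtain n p where np: "\<And>z. cmod z = 1 \<Longrightarrow> complex_of_real (g z) = cnj z ^ n * poly p z"
      using real_polynomial_function_circle[OF g] by blast
    have [measurable]: "g \<in> borel_measurable borel"
      using g by (intro borel_measurable_continuous_onI continuous_on_polymonial_function)
        (simp add: real_polynomial_function_eq)
    have int: "complex_of_real (\<integral>z. g z \<partial>L) = (\<Sum>k\<le>degree p. coeff p k * (\<integral>z. cnj z ^ n * z ^ k \<partial>L))"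
      if "circle_measure L" for L
    proof -
      interpret L: circle_measure L by fact
      have "complex_of_real (\<integral>z. g z \<partial>L) = (\<integral>z. complex_of_real (g z) \<partial>L)"
        by (rule integral_complex_of_real[symmetric])
      also have "\<dots> = (\<integral>z. (\<Sum>k\<le>degree p. coeff p k * (cnj z ^ n * z ^ k)) \<partial>L)"
      proof (rule integral_cong_AE)
        show "AE z in L. complex_of_real (g z) = (\<Sum>k\<le>degree p. coeff p k * (cnj z ^ n * z ^ k))"
          using L.AE_circle
          by eventually_elim (simp add: np poly_altdef sum_distrib_left mult_ac)
      qed measurable
      also have "\<dots> = (\<Sum>k\<le>degree p. \<integral>z. coeff p k * (cnj z ^ n * z ^ k) \<partial>L)"
        by (rule Bochner_Integration.integral_sum)
           (intro L.integrable_continuous continuous_intros)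
      finally show ?thesis by simp
    qed
    have "complex_of_real (\<integral>z. g z \<partial>M) = complex_of_real (\<integral>z. g z \<partial>N)"
      unfolding int[OF assms(1)] int[OF assms(2)]
      by (simp add: M.integral_cnj_power_mult_power N.integral_cnj_power_mult_power moments cong: if_cong)
    thus ?thesis by (simp only: of_real_eq_iff)
  qed
  have approx: "\<bar>(\<integral>z. f z \<partial>L) - (\<integral>z. g z \<partial>L)\<bar> \<le> e * measure L UNIV"
    if "circle_measure L" and g: "continuous_on UNIV g" and "\<And>z. z \<in> sphere 0 1 \<Longrightarrow> \<bar>f z - g z\<bar> < e"
    for e g L
  proof -
    interpret L: circle_measure L by fact
    have "\<bar>(\<integral>z. f z \<partial>L) - (\<integral>z. g z \<partial>L)\<bar> = \<bar>\<integral>z. f z - g z \<partial>L\<bar>"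
      using f g by (subst Bochner_Integration.integral_diff) (auto intro: L.integrable_continuous)
    also have "\<dots> \<le> (\<integral>z. \<bar>f z - g z\<bar> \<partial>L)"
      by (rule integral_abs_bound)
    also have "\<dots> \<le> (\<integral>z. e \<partial>L)"
    proof (rule integral_mono_AE)
      show "AE z in L. \<bar>f z - g z\<bar> \<le> e"
        using L.AE_circle by eventually_elim (use that(3) in \<open>auto intro: less_imp_le\<close>)
    qed (use f g in \<open>auto intro!: L.integrable_continuous continuous_intros\<close>)
    finally show ?thesis by (simp add: mult.commute)
  qed
  have "\<bar>(\<integral>z. f z \<partial>M) - (\<integral>z. f z \<partial>N)\<bar> \<le> 0 + e" if "e > 0" for e
  proof -
    \<comment> \<open>The summand 1 keeps \<open>K\<close> positive even if both measures vanish; an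
      error of e / K per unit of mass adds up to at most e.\<close>
    define K where "K = measure M UNIV + measure N UNIV + 1"
    have K: "K > 0"
      unfolding K_def by (intro add_nonneg_pos add_nonneg_nonneg measure_nonneg) simp
    obtain g where g: "real_polynomial_function g" "\<And>z. z \<in> sphere 0 1 \<Longrightarrow> \<bar>f z - g z\<bar> < e / K"
      using Stone_Weierstrass_real_polynomial_function[of "sphere 0 1" f "e / K"]
        continuous_on_subset[OF f] K \<open>e > 0\<close> by auto
    have "continuous_on UNIV g"
      using g(1) by (intro continuous_on_polymonial_function) (simp add: real_polynomial_function_eq)
    from approx[OF assms(1) this g(2)] approx[OF assms(2) this g(2)]
    have "\<bar>(\<integral>z. f z \<partial>M) - (\<integral>z. f z \<partial>N)\<bar> \<le> e / K * measure M UNIV + e / K * measure N UNIV"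
      using polyfun[OF g(1)] by linarith
    also have "\<dots> \<le> e / K * K"
      unfolding K_def distrib_left using K \<open>e > 0\<close> by (simp flip: K_def)
    also have "\<dots> = e" using K by simp
    finally show ?thesis by simp
  qed
  hence "\<bar>(\<integral>z. f z \<partial>M) - (\<integral>z. f z \<partial>N)\<bar> \<le> 0"
    by (rule field_le_epsilon)
  thus ?thesis by simp
qed

text \<open>Indicators of open sets are pointwise limits of bounded continuous functions, so
  equality of integrals passes to open sets, an intersection-stable generator of the Borel
  sets.\<close>

lemma circle_measure_eqI:
  assumes "circle_measure M" "circle_measure N"
    and moments: "\<And>k. (\<integral>z. z ^ k \<partial>M) = (\<integral>z. z ^ k \<partial>N)"
  shows "M = N"
proof -
  interpret M: circle_measure M by fact
  interpret N: circle_measure N by fact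
  have eq: "emeasure M U = emeasure N U" if U: "open U" for U
  proof -
    \<comment> \<open>The case \<open>UNIV\<close> is separate because \<open>infdist\<close> to the
      empty set is 0 by convention.\<close>
    define f :: "nat \<Rightarrow> complex \<Rightarrow> real" where
      "f n z = (if U = UNIV then 1 else min 1 (real n * infdist z (- U)))" for n z
    have cont: "continuous_on UNIV (f n)" for n
      unfolding f_def by (cases "U = UNIV") (auto intro!: continuous_intros)
    have lim: "(\<lambda>n. f n z) \<longlonglongrightarrow> indicator U z" for z
    proof (cases "U = UNIV")
      case False
      hence ne: "- U \<noteq> {}" and cl: "closed (- U)" using U by auto
      show ?thesis
      proof (cases "z \<in> U")
        case True
        hence pos: "infdist z (- U) > 0"
          using infdist_pos_not_in_closed[OF cl ne] by blast
        have "\<forall>\<^sub>F n in sequentially. f n z = 1"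
        proof -
          obtain m where m: "1 < real m * infdist z (- U)"
            using reals_Archimedean3[OF pos] by blast
          have "f n z = 1" if "n \<ge> m" for n
          proof -
            have "1 < real n * infdist z (- U)"
              using m that pos by (intro less_le_trans[OF m] mult_right_mono) auto
            thus ?thesis using False by (simp add: f_def)
          qed
          thus ?thesis by (auto simp: eventually_sequentially)
        qed
        thus ?thesis using True by (simp add: tendsto_eventually)
      next
        case False
        hence "infdist z (- U) = 0"
          using in_closed_iff_infdist_zero[OF cl ne] by blast
        thus ?thesis using False \<open>U \<noteq> UNIV\<close> by (simp add: f_def)
      qed
    qed (simp add: f_def)
    have bd: "\<bar>f n z\<bar> \<le> 1" for n z
      by (simp add: f_def infdist_nonneg)
    have meas: "(\<lambda>n. \<integral>z. f n z \<partial>L) \<longlonglongrightarrow> measure L U" if "circle_measure L" for L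
    proof -
      interpret L: circle_measure L by fact
      have [measurable]: "f n \<in> borel_measurable borel" for n
        using cont by (rule borel_measurable_continuous_onI)
      have [measurable]: "U \<in> sets borel" using U by simp
      have "(\<lambda>n. \<integral>z. f n z \<partial>L) \<longlonglongrightarrow> (\<integral>z. indicator U z \<partial>L)"
        by (rule integral_dominated_convergence[where w = "\<lambda>_. 1"]) (use lim bd in auto)
      thus ?thesis by simp
    qed
    have "(\<lambda>n. \<integral>z. f n z \<partial>M) = (\<lambda>n. \<integral>z. f n z \<partial>N)"
      using circle_measure_integral_eqI[OF assms cont] by blast
    hence "measure M U = measure N U"
      using meas[OF assms(1)] meas[OF assms(2)] LIMSEQ_unique by metis
    thus ?thesis
      by (simp add: M.emeasure_eq_measure N.emeasure_eq_measure)
  qed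
  show ?thesis
  proof (rule measure_eqI_generator_eq[where E = "Collect open" and \<Omega> = UNIV and A = "\<lambda>_. UNIV"])
    show "Int_stable (Collect open :: complex set set)"
      by (auto simp: Int_stable_def)
  qed (use eq in \<open>auto simp: borel_def\<close>)
qed

subsection \<open>Integrals over one period and the Schwarz formula\<close>

lemma normalized_dtheta_eq_density:
  "normalized_dtheta = density lborel (\<lambda>\<theta>. ennreal (indicator {0..<2 * pi} \<theta> / (2 * pi)))"
  unfolding normalized_dtheta_def uniform_measure_def
  by (intro density_cong) (auto intro!: AE_I2 simp: indicator_def divide_ennreal[symmetric] simp flip: ennreal_1)

lemma sets_normalized_dtheta [measurable_cong, simp]: "sets normalized_dtheta = sets borel"
  by (simp add: normalized_dtheta_def)

lemma space_normalized_dtheta [simp]: "space normalized_dtheta = UNIV"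
  by (simp add: normalized_dtheta_def)

lemma prob_space_normalized_dtheta: "prob_space normalized_dtheta"
  unfolding normalized_dtheta_def by (rule prob_space_uniform_measure) auto

lemma AE_normalized_dtheta: "AE \<theta> in normalized_dtheta. 0 \<le> \<theta> \<and> \<theta> < 2 * pi"
  unfolding normalized_dtheta_def by (rule AE_uniform_measureI) auto

lemma AE_normalized_dtheta_iff:
  assumes [measurable]: "Measurable.pred borel P"
  shows "(AE \<theta> in normalized_dtheta. P \<theta>) \<longleftrightarrow> (AE \<theta> in lborel. \<theta> \<in> {0..<2 * pi} \<longrightarrow> P \<theta>)"
  unfolding normalized_dtheta_def by (subst AE_uniform_measure) auto

lemma integral_normalized_dtheta:
  fixes f :: "real \<Rightarrow> complex"
  assumes [measurable]: "f \<in> borel_measurable borel"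
  shows "(\<integral>\<theta>. f \<theta> \<partial>normalized_dtheta) = (LBINT \<theta>:{0..<2 * pi}. f \<theta>) / complex_of_real (2 * pi)"
proof -
  have "(\<integral>\<theta>. f \<theta> \<partial>normalized_dtheta) = (LBINT \<theta>. (indicator {0..<2 * pi} \<theta> / (2 * pi)) *\<^sub>R f \<theta>)"
    unfolding normalized_dtheta_eq_density by (subst integral_density) auto
  also have "\<dots> = (LBINT \<theta>. (1 / (2 * pi)) *\<^sub>R (indicator {0..<2 * pi} \<theta> *\<^sub>R f \<theta>))"
    by simp
  also have "\<dots> = (1 / (2 * pi)) *\<^sub>R (LBINT \<theta>:{0..<2 * pi}. f \<theta>)"
    unfolding set_lebesgue_integral_def by (rule integral_scaleR_right)
  finally show ?thesis
    by (simp add: scaleR_conv_of_real)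
qed

lemma set_integrable_circle:
  fixes f :: "real \<Rightarrow> complex"
  assumes "continuous_on UNIV f"
  shows "set_integrable lborel {0..<2 * pi} f"
  by (rule set_integrable_subset[OF borel_integrable_atLeastAtMost'[of 0 "2 * pi", OF continuous_on_subset[OF assms]]])
     auto

lemma set_integral_circle_eq_integral:
  fixes f :: "real \<Rightarrow> complex"
  assumes "continuous_on UNIV f"
  shows "(LBINT \<theta>:{0..<2 * pi}. f \<theta>) = integral {0..2 * pi} f"
proof -
  have [measurable]: "f \<in> borel_measurable borel"
    using assms by (rule borel_measurable_continuous_onI)
  have "(LBINT \<theta>:{0..<2 * pi}. f \<theta>) = (LBINT \<theta>:{0..2 * pi}. f \<theta>)"
    unfolding set_lebesgue_integral_def
  proof (rule integral_cong_AE)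
    show "AE \<theta> in lborel. indicator {0..<2 * pi} \<theta> *\<^sub>R f \<theta> = indicator {0..2 * pi} \<theta> *\<^sub>R f \<theta>"
      using AE_lborel_singleton[of "2 * pi"] by eventually_elim (auto simp: indicator_def)
  qed auto
  also have "\<dots> = integral {0..2 * pi} f"
    by (rule set_borel_integral_eq_integral(2)[OF borel_integrable_atLeastAtMost'])
       (rule continuous_on_subset[OF assms], auto)
  finally show ?thesis .
qed

section \<open>Cauchy, mean value and Schwarz formulas on the unit circle\<close>

lemma continuous_on_cis_compose:
  assumes "continuous_on (sphere 0 1) f"
  shows "continuous_on UNIV (\<lambda>\<theta>. f (cis \<theta>))"
  by (rule continuous_on_compose2[OF assms]) (auto intro!: continuous_intros)

lemma cis_neq: "cmod z < 1 \<Longrightarrow> cis \<theta> - z \<noteq> 0"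
  by (metis norm_cis less_irrefl right_minus_eq)

text \<open>Cauchy's formula with u = \<open>cis t\<close>: as du = i u dt, a factor
  \<open>cis t\<close> remains in the integrand, and i is removed by multiplying with -i.\<close>

lemma set_integral_cauchy_circle:
  fixes h :: "complex \<Rightarrow> complex"
  assumes h: "h holomorphic_on cball 0 1" and z: "cmod z < 1"
  shows "(LBINT \<theta>:{0..<2 * pi}. cis \<theta> / (cis \<theta> - z) * h (cis \<theta>)) = 2 * pi * h z"
proof -
  have "((\<lambda>u. h u / (u - z)) has_contour_integral (2 * pi * \<i> * h z)) (circlepath 0 1)"
    using Cauchy_integral_circlepath_simple[OF h, of z] z by simp
  hence "((\<lambda>t. h (0 + 1 * cis t) / (0 + 1 * cis t - z) * 1 * \<i> * cis t) has_integral
           (2 * pi * \<i> * h z)) {0..2 * pi}"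
    unfolding circlepath_def by (subst (asm) has_contour_integral_part_circlepath_iff) simp_all
  hence "((\<lambda>t. - \<i> * (h (0 + 1 * cis t) / (0 + 1 * cis t - z) * 1 * \<i> * cis t)) has_integral
           (- \<i> * (2 * pi * \<i> * h z))) {0..2 * pi}"
    by (rule has_integral_mult_right)
  also have "(\<lambda>t. - \<i> * (h (0 + 1 * cis t) / (0 + 1 * cis t - z) * 1 * \<i> * cis t)) =
               (\<lambda>t. cis t / (cis t - z) * h (cis t))"
    by (auto simp: algebra_simps)
  also have "- \<i> * (2 * pi * \<i> * h z) = 2 * pi * h z"
    by (simp add: algebra_simps)
  finally have "integral {0..2 * pi} (\<lambda>t. cis t / (cis t - z) * h (cis t)) = 2 * pi * h z"
    by (rule integral_unique)
  moreover have "continuous_on UNIV (\<lambda>t. cis t / (cis t - z) * h (cis t))"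
    by (intro continuous_intros continuous_on_cis_compose cis_neq z ballI
          holomorphic_on_imp_continuous_on holomorphic_on_subset[OF h]) auto
  ultimately show ?thesis
    by (simp add: set_integral_circle_eq_integral)
qed

lemma set_integral_mean_value_circle:
  fixes h :: "complex \<Rightarrow> complex"
  assumes h: "h holomorphic_on cball 0 1"
  shows "(LBINT \<theta>:{0..<2 * pi}. h (cis \<theta>)) = 2 * pi * h 0"
  using set_integral_cauchy_circle[OF h, of 0] by simp

text \<open>With 2 Re h = h + cnj h the integral splits. The h part is Cauchy's formula, as (e +
  z)/(e - z) = 2 e/(e - z) - 1; the cnj h part is the conjugate of a mean value. The two
  contributions of h(0) cancel because h(0) is real.\<close>

lemma set_integral_schwarz_circle:
  fixes h :: "complex \<Rightarrow> complex"
  assumes h: "h holomorphic_on cball 0 1" and z: "cmod z < 1" and real: "Im (h 0) = 0"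
  shows "(LBINT \<theta>:{0..<2 * pi}. (cis \<theta> + z) / (cis \<theta> - z) * complex_of_real (2 * Re (h (cis \<theta>))))
           = 4 * pi * h z"
proof -
  \<comment> \<open>On the circle (e + z)/(e - z) is the conjugate of (1 + cnj z e)/(1 - cnj z e),
    which has no pole in the closed disk.\<close>
  define k where "k = (\<lambda>u. (1 + cnj z * u) / (1 - cnj z * u) * h u)"
  have nz: "1 - cnj z * u \<noteq> 0" if "u \<in> cball 0 1" for u
  proof
    assume "1 - cnj z * u = 0"
    hence "cmod (cnj z * u) = 1" by simp
    moreover have "cmod (cnj z * u) \<le> cmod z * 1"
      using that unfolding norm_mult complex_mod_cnj by (intro mult_left_mono) auto
    ultimately show False using z by simp
  qed
  have k: "k holomorphic_on cball 0 1"
    unfolding k_def by (intro holomorphic_intros h nz)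
  have conth: "continuous_on UNIV (\<lambda>\<theta>. h (cis \<theta>))" and contk: "continuous_on UNIV (\<lambda>\<theta>. k (cis \<theta>))"
    by (rule continuous_on_cis_compose,
        rule continuous_on_subset[OF holomorphic_on_imp_continuous_on[OF h]], force,
        rule continuous_on_cis_compose,
        rule continuous_on_subset[OF holomorphic_on_imp_continuous_on[OF k]], force)
  have contc: "continuous_on UNIV (\<lambda>t. cis t / (cis t - z) * h (cis t))"
    by (intro continuous_intros conth cis_neq z ballI)
  have eq: "(cis \<theta> + z) / (cis \<theta> - z) * complex_of_real (2 * Re (h (cis \<theta>))) =
          (2 * (cis \<theta> / (cis \<theta> - z) * h (cis \<theta>)) - h (cis \<theta>)) + cnj (k (cis \<theta>))" for \<theta>
  proof -
    define e where "e = cis \<theta>"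
    have ne: "e - z \<noteq> 0" and e: "e * cnj e = 1"
      using cis_neq[OF z] by (simp_all add: e_def cis_cnj cis_mult)
    have "1 - z * cnj e \<noteq> 0"
      using nz[of e] by (metis complex_cnj_cnj complex_cnj_diff complex_cnj_mult complex_cnj_one
            complex_cnj_zero_iff e_def mem_cball_0 norm_cis order_refl)
    moreover have "(e + z) * (1 - z * cnj e) = (1 + z * cnj e) * (e - z)"
      using e by (simp add: algebra_simps)
    ultimately have "(1 + z * cnj e) / (1 - z * cnj e) = (e + z) / (e - z)"
      using ne by (simp add: frac_eq_eq)
    moreover have "cnj (k e) = (1 + z * cnj e) / (1 - z * cnj e) * cnj (h e)"
      by (simp add: k_def)
    ultimately have "cnj (k e) = (e + z) / (e - z) * cnj (h e)"
      by (simp only:)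
    moreover have "2 * (e / (e - z) * h e) - h e = (e + z) / (e - z) * h e"
      using ne by (simp add: field_simps)
    moreover have "complex_of_real (2 * Re (h e)) = h e + cnj (h e)"
      by (simp add: complex_add_cnj)
    ultimately show ?thesis
      by (simp add: e_def ring_distribs)
  qed
  have "(LBINT \<theta>:{0..<2 * pi}. (cis \<theta> + z) / (cis \<theta> - z) * complex_of_real (2 * Re (h (cis \<theta>))))
      = (LBINT \<theta>:{0..<2 * pi}. (2 * (cis \<theta> / (cis \<theta> - z) * h (cis \<theta>)) - h (cis \<theta>)) + cnj (k (cis \<theta>)))"
    by (simp only: eq)
  also have "\<dots> = (LBINT \<theta>:{0..<2 * pi}. 2 * (cis \<theta> / (cis \<theta> - z) * h (cis \<theta>)))
                 - (LBINT \<theta>:{0..<2 * pi}. h (cis \<theta>)) + (LBINT \<theta>:{0..<2 * pi}. cnj (k (cis \<theta>)))"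
    by (subst set_integral_add set_integral_diff;
        (intro set_integrable_circle continuous_intros conth contk contc)?)+ simp
  also have "(LBINT \<theta>:{0..<2 * pi}. cnj (k (cis \<theta>))) = cnj (LBINT \<theta>:{0..<2 * pi}. k (cis \<theta>))"
    unfolding set_lebesgue_integral_def
    by (subst Bochner_Integration.integral_cnj[symmetric]) simp
  also have "(LBINT \<theta>:{0..<2 * pi}. k (cis \<theta>)) = 2 * pi * h 0"
    by (subst set_integral_mean_value_circle[OF k]) (simp add: k_def)
  also have "(LBINT \<theta>:{0..<2 * pi}. 2 * (cis \<theta> / (cis \<theta> - z) * h (cis \<theta>))) = 4 * pi * h z"
    by (subst set_integral_mult_right, subst set_integral_cauchy_circle[OF h z]) simp
  also have "(LBINT \<theta>:{0..<2 * pi}. h (cis \<theta>)) = 2 * pi * h 0"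
    by (rule set_integral_mean_value_circle[OF h])
  also have "cnj (2 * pi * h 0) = 2 * pi * h 0"
    using real by (simp add: complex_eq_iff)
  finally show ?thesis by simp
qed

text \<open>Inverse of \<open>cis\<close> on $[0, 2\pi)$. Clamping \<open>Re z\<close> to $[-1, 1]$ keeps \<open>arccos\<close> on the
  interval where it is continuous, which makes the function measurable on the whole plane.\<close>

definition circle_angle :: "complex \<Rightarrow> real" where
  "circle_angle z = (let a = arccos (max (- 1) (min 1 (Re z))) in if 0 \<le> Im z then a else 2 * pi - a)"

lemma borel_measurable_circle_angle [measurable]: "circle_angle \<in> borel_measurable borel"
proof -
  have [measurable]: "(\<lambda>x. arccos (max (- 1) (min 1 x))) \<in> borel_measurable borel"
    by (intro borel_measurable_continuous_onI continuous_on_compose2[OF continuous_on_arccos']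
         continuous_intros) auto
  show ?thesis unfolding circle_angle_def Let_def by measurable
qed

lemma circle_angle_cis:
  assumes "0 \<le> \<theta>" "\<theta> < 2 * pi"
  shows "circle_angle (cis \<theta>) = \<theta>"
proof (cases "\<theta> \<le> pi")
  case True
  thus ?thesis
    using assms by (simp add: circle_angle_def sin_ge_zero arccos_cos)
next
  case False
  have "cos \<theta> = cos (2 * pi - \<theta>)" by simp
  hence "arccos (cos \<theta>) = 2 * pi - \<theta>"
    using assms False by (metis arccos_cos diff_ge_0_iff_ge less_eq_real_def linorder_not_le diff_le_eq
       add.commute mult_2 add_le_cancel_left)
  thus ?thesis
    using assms False sin_lt_zero[of \<theta>] by (simp add: circle_angle_def)
qed

lemma measurable_cis [measurable]: "cis \<in> borel_measurable borel"
  by (intro borel_measurable_continuous_onI continuous_intros)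

text \<open>Uniqueness of densities, tested on sets that avoid the null set \<open>N\<close>
  carrying \<open>\<mu>s\<close>. Preimages under \<open>circle_angle\<close> replace images under
  \<open>cis\<close>, so that Borel measurability is immediate.\<close>

lemma circle_lebesgue_decomposition_density:
  assumes dec: "circle_lebesgue_decomposition \<mu> w \<mu>s"
    and v [measurable]: "v \<in> borel_measurable borel" and v0: "\<And>\<theta>. 0 \<le> v \<theta>"
    and \<mu>: "\<mu> = distr (density normalized_dtheta (\<lambda>\<theta>. ennreal (v \<theta>))) borel cis"
  shows "AE \<theta> in normalized_dtheta. w \<theta> = v \<theta>"
proof -
  interpret prob_space normalized_dtheta by (rule prob_space_normalized_dtheta)
  from dec have [measurable]: "w \<in> borel_measurable borel" and w0: "\<And>\<theta>. 0 \<le> w \<theta>"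
    and eq: "\<And>A. A \<in> sets borel \<Longrightarrow> emeasure \<mu> A =
        emeasure (distr (density normalized_dtheta (\<lambda>\<theta>. ennreal (w \<theta>))) borel cis) A + emeasure \<mu>s A"
    and \<mu>s: "sets \<mu>s = sets borel"
    by (auto simp: circle_lebesgue_decomposition_def)
  from dec obtain N where N [measurable]: "N \<in> sets borel"
    and N0: "emeasure (distr normalized_dtheta borel cis) N = 0" "emeasure \<mu>s (- N) = 0"
    by (auto simp: circle_lebesgue_decomposition_def)
  have "emeasure normalized_dtheta (cis -` N) = 0"
    using N0(1) by (subst (asm) emeasure_distr) auto
  hence AE_N: "AE \<theta> in normalized_dtheta. cis \<theta> \<notin> N"
    by (subst AE_iff_measurable[OF _ refl]) (auto simp: vimage_def)
  have "AE \<theta> in normalized_dtheta. ennreal (w \<theta>) = ennreal (v \<theta>)"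
  proof (rule density_unique_finite_measure)
    fix A assume "A \<in> sets normalized_dtheta"
    hence A [measurable]: "A \<in> sets borel" by simp
    \<comment> \<open>The preimage of \<open>B\<close> under \<open>cis\<close> agrees with
      \<open>A\<close> up to a null set of \<open>normalized_dtheta\<close>, while
      \<open>\<mu>s\<close> gives \<open>B\<close> no mass.\<close>
    define B where "B = circle_angle -` A - N"
    have B [measurable]: "B \<in> sets borel"
      using measurable_sets[OF borel_measurable_circle_angle A] by (auto simp: B_def)
    have *: "(\<integral>\<^sup>+\<theta>. ennreal (u \<theta>) * indicator A \<theta> \<partial>normalized_dtheta) =
          emeasure (distr (density normalized_dtheta (\<lambda>\<theta>. ennreal (u \<theta>))) borel cis) B"
      if [measurable]: "u \<in> borel_measurable borel" for u
    proof -
      have [measurable]: "cis -` B \<in> sets borel"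
        using measurable_sets[OF measurable_cis B] by simp
      have "emeasure (distr (density normalized_dtheta (\<lambda>\<theta>. ennreal (u \<theta>))) borel cis) B =
              emeasure (density normalized_dtheta (\<lambda>\<theta>. ennreal (u \<theta>))) (cis -` B)"
        by (subst emeasure_distr) auto
      also have "\<dots> = (\<integral>\<^sup>+\<theta>. ennreal (u \<theta>) * indicator (cis -` B) \<theta> \<partial>normalized_dtheta)"
        by (subst emeasure_density) auto
      also have "\<dots> = (\<integral>\<^sup>+\<theta>. ennreal (u \<theta>) * indicator A \<theta> \<partial>normalized_dtheta)"
      proof (rule nn_integral_cong_AE)
        show "AE \<theta> in normalized_dtheta. ennreal (u \<theta>) * indicator (cis -` B) \<theta> =
                ennreal (u \<theta>) * indicator A \<theta>"
          using AE_N AE_normalized_dtheta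
          by eventually_elim (auto simp: B_def indicator_def circle_angle_cis)
      qed
      finally show ?thesis ..
    qed
    have "emeasure \<mu>s B \<le> emeasure \<mu>s (- N)"
      by (rule emeasure_mono) (auto simp: B_def \<mu>s)
    hence "emeasure \<mu>s B = 0"
      using N0(2) by simp
    thus "(\<integral>\<^sup>+\<theta>. ennreal (w \<theta>) * indicator A \<theta> \<partial>normalized_dtheta) =
          (\<integral>\<^sup>+\<theta>. ennreal (v \<theta>) * indicator A \<theta> \<partial>normalized_dtheta)"
      using eq[OF B] by (simp add: * \<mu>)
  qed auto
  thus ?thesis
    by eventually_elim (use w0 v0 in auto)
qed

subsection \<open>Orthogonal polynomials and the Szego recursion\<close>

text \<open>The level \<open>n\<close> is a parameter and not the degree, since the Szego recursion
  also reverses polynomials of degree at most n at level n + 1, which leaves an extra factor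
  z.\<close>

definition conj_reverse :: "nat \<Rightarrow> complex poly \<Rightarrow> complex poly" where
  "conj_reverse n p = (\<Sum>i\<le>n. monom (cnj (coeff p (n - i))) i)"

lemma coeff_conj_reverse:
  "coeff (conj_reverse n p) i = (if i \<le> n then cnj (coeff p (n - i)) else 0)"
  by (simp add: conj_reverse_def coeff_sum)

lemma poly_conj_reverse:
  assumes "degree p \<le> n" "z \<noteq> 0"
  shows "poly (conj_reverse n p) z = z ^ n * cnj (poly p (1 / cnj z))"
proof -
  have "poly p (1 / cnj z) = (\<Sum>i\<le>n. coeff p i * (1 / cnj z) ^ i)"
    by (subst poly_as_sum_of_monoms'[OF assms(1), symmetric]) (simp add: poly_sum poly_monom)
  hence "z ^ n * cnj (poly p (1 / cnj z)) = (\<Sum>i\<le>n. cnj (coeff p i) * (z ^ n * (1 / z) ^ i))"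
    by (simp add: sum_distrib_left mult_ac)
  also have "\<dots> = (\<Sum>i\<le>n. cnj (coeff p i) * z ^ (n - i))"
    using assms(2) by (intro sum.cong) (auto simp: power_diff power_one_over)
  also have "\<dots> = (\<Sum>i\<le>n. cnj (coeff p (n - i)) * z ^ i)"
    by (subst sum.nat_diff_reindex[symmetric, of _ "Suc n", unfolded lessThan_Suc_atMost]) simp
  finally show ?thesis
    by (simp add: conj_reverse_def poly_sum poly_monom)
qed

lemma cnj_eq_inverse_on_circle: "cmod z = 1 \<Longrightarrow> 1 / cnj z = z"
  by (metis complex_div_cnj complex_cnj_one complex_cnj_cnj div_by_1 mult_1 norm_one of_real_1 power_one
      complex_mod_cnj)

lemma poly_conj_reverse_circle:
  assumes "degree p \<le> n" "cmod z = 1"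
  shows "poly (conj_reverse n p) z = z ^ n * cnj (poly p z)"
  using poly_conj_reverse[OF assms(1), of z] assms(2) cnj_eq_inverse_on_circle[OF assms(2)] by force

lemma conj_reverse_diff_smult:
  "conj_reverse n (p - smult c q) = conj_reverse n p - smult (cnj c) (conj_reverse n q)"
  by (rule poly_eqI) (simp add: coeff_conj_reverse)

lemma conj_reverse_pCons: "conj_reverse (Suc n) (pCons 0 p) = conj_reverse n p"
  by (rule poly_eqI) (auto simp: coeff_conj_reverse coeff_pCons Suc_diff_le split: nat.splits)

lemma conj_reverse_conj_reverse:
  assumes "degree p \<le> n"
  shows "conj_reverse (Suc n) (conj_reverse n p) = pCons 0 p"
  using assms
  by (intro poly_eqI)
     (auto simp: coeff_conj_reverse coeff_pCons coeff_eq_0 split: nat.splits)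

lemma conj_reverse_0_1 [simp]: "conj_reverse 0 1 = 1"
  by (simp add: conj_reverse_def monom_0)

locale nontrivial_circle_measure =
  fixes \<mu> :: "complex measure"
  assumes nontrivial: "nontrivial_circle_prob \<mu>"
begin

sublocale prob_space \<mu>
  using nontrivial by (simp add: nontrivial_circle_prob_def)

sublocale circle_measure \<mu>
  using nontrivial by unfold_locales (auto simp: nontrivial_circle_prob_def)

lemma not_AE_finite: "finite F \<Longrightarrow> \<not> (AE z in \<mu>. z \<in> F)"
  using nontrivial by (simp add: nontrivial_circle_prob_def)

definition ip :: "complex poly \<Rightarrow> complex poly \<Rightarrow> complex" where
  "ip p q = (\<integral>z. cnj (poly p z) * poly q z \<partial>\<mu>)"

lemma ip_integrable [simp]: "integrable \<mu> (\<lambda>z. cnj (poly p z) * poly q z)"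
  by (intro integrable_continuous continuous_intros)

lemma ip_right:
  "ip p (q + r) = ip p q + ip p r" "ip p (q - r) = ip p q - ip p r" "ip p (smult c q) = c * ip p q"
proof -
  have *: "(\<lambda>z. cnj (poly p z) * poly (smult c q) z) = (\<lambda>z. c * (cnj (poly p z) * poly q z))"
    by (simp add: mult_ac)
  show "ip p (smult c q) = c * ip p q"
    unfolding ip_def * by simp
qed (simp_all add: ip_def ring_distribs)

lemma cnj_ip: "cnj (ip p q) = ip q p"
proof -
  have "ip q p = (\<integral>z. cnj (cnj (poly p z) * poly q z) \<partial>\<mu>)"
    by (simp add: ip_def mult.commute)
  also have "\<dots> = cnj (ip p q)"
    unfolding ip_def by (rule Bochner_Integration.integral_cnj)
  finally show ?thesis ..
qed

lemma ip_left:
  "ip (q + r) p = ip q p + ip r p" "ip (q - r) p = ip q p - ip r p" "ip (smult c q) p = cnj c * ip q p"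
  by (metis cnj_ip ip_right complex_cnj_add, metis cnj_ip ip_right complex_cnj_diff,
      metis cnj_ip ip_right complex_cnj_mult)

lemma ip_0_left [simp]: "ip 0 p = 0"
  by (simp add: ip_def)

lemma ip_sum_left: "ip (sum f A) p = (\<Sum>i\<in>A. ip (f i) p)"
  by (induction A rule: infinite_finite_induct) (auto simp: ip_left)

definition norm2 :: "complex poly \<Rightarrow> real" where
  "norm2 p = (\<integral>z. (cmod (poly p z))\<^sup>2 \<partial>\<mu>)"

lemma ip_self: "ip p p = complex_of_real (norm2 p)"
  unfolding ip_def norm2_def
  by (subst integral_complex_of_real[symmetric], simp only: complex_norm_square, simp only: mult.commute)

text \<open>Here the nontriviality of \<open>\<mu>\<close> enters: a nonzero polynomial of norm zero
  would confine the measure to its finite set of roots.\<close>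

lemma norm2_pos:
  assumes "p \<noteq> 0"
  shows "norm2 p > 0"
proof -
  have int: "integrable \<mu> (\<lambda>z. (cmod (poly p z))\<^sup>2)"
    by (intro integrable_continuous continuous_intros)
  have "norm2 p \<noteq> 0"
  proof
    assume "norm2 p = 0"
    hence "AE z in \<mu>. (cmod (poly p z))\<^sup>2 = 0"
      using integral_nonneg_eq_0_iff_AE[OF int] by (simp add: norm2_def)
    hence "AE z in \<mu>. z \<in> {z. poly p z = 0}"
      by simp
    thus False
      using not_AE_finite[OF poly_roots_finite[OF assms]] by blast
  qed
  moreover have "norm2 p \<ge> 0"
    by (simp add: norm2_def)
  ultimately show ?thesis by linarith
qed

definition monic_orthogonal :: "nat \<Rightarrow> complex poly \<Rightarrow> bool" where
  "monic_orthogonal n p \<longleftrightarrow> degree p = n \<and> lead_coeff p = 1 \<and> (\<forall>j<n. ip (monom 1 j) p = 0)"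

text \<open>Testing only the monomials that occur in \<open>q\<close> covers both \<Phi>_n,
  orthogonal to the powers below n, and its reversal, orthogonal to z, ..., z^n but not to
  1.\<close>

lemma ip_eq_0:
  assumes "\<And>j. coeff q j \<noteq> 0 \<Longrightarrow> ip (monom 1 j) p = 0"
  shows "ip q p = 0"
proof -
  have "ip q p = ip (\<Sum>i\<le>degree q. monom (coeff q i) i) p"
    by (simp add: poly_as_sum_of_monoms)
  also have "\<dots> = (\<Sum>i\<le>degree q. ip (smult (coeff q i) (monom 1 i)) p)"
    by (simp add: ip_sum_left smult_monom)
  also have "\<dots> = 0"
    by (intro sum.neutral ballI) (metis assms complex_cnj_zero ip_left(3) mult_eq_0_iff)
  finally show ?thesis .
qed

lemma monic_orthogonal_unique:
  assumes "monic_orthogonal n p" "monic_orthogonal n q"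
  shows "p = q"
proof (rule ccontr)
  assume "p \<noteq> q"
  \<comment> \<open>The leading terms cancel, so p - q has only powers below n; it is orthogonal to
    \<open>p\<close> and \<open>q\<close>, hence to itself.\<close>
  have *: "coeff (p - q) j = 0" if "j \<ge> n" for j
  proof (cases "j = n")
    case True
    thus ?thesis
      using assms unfolding monic_orthogonal_def by (metis coeff_diff diff_self)
  next
    case False
    hence "coeff p j = 0" "coeff q j = 0"
      using that assms unfolding monic_orthogonal_def by (metis coeff_eq_0 le_neq_implies_less)+
    thus ?thesis by simp
  qed
  have "ip (p - q) (p - q) = 0"
  proof (rule ip_eq_0)
    fix j assume "coeff (p - q) j \<noteq> 0"
    hence "j < n"
      using * not_le by blast
    hence "ip (monom 1 j) p = 0" "ip (monom 1 j) q = 0"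
      using assms unfolding monic_orthogonal_def by blast+
    thus "ip (monom 1 j) (p - q) = 0"
      by (simp add: ip_right)
  qed
  thus False
    using norm2_pos[of "p - q"] \<open>p \<noteq> q\<close> by (simp add: ip_self)
qed

text \<open>On the circle the reversal is z^n cnj(p z), and \<open>cnj z ^ j * z ^ n\<close> is z^(n
  - j).\<close>

lemma ip_monom_conj_reverse:
  assumes "degree p \<le> n" "j \<le> n"
  shows "ip (monom 1 j) (conj_reverse n p) = cnj (ip (monom 1 (n - j)) p)"
  unfolding cnj_ip unfolding ip_def
proof (rule integral_cong_AE)
  show "AE z in \<mu>. cnj (poly (monom 1 j) z) * poly (conj_reverse n p) z =
          cnj (poly p z) * poly (monom 1 (n - j)) z"
    using AE_circle
  proof eventually_elim
    fix z :: complex assume z: "cmod z = 1"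
    have "cnj z * z = 1"
      by (rule cnj_mult_self_circle[OF z])
    hence "cnj z ^ j * z ^ j = 1"
      by (metis power_mult_distrib power_one)
    moreover have "z ^ n = z ^ j * z ^ (n - j)"
      using assms(2) by (simp flip: power_add)
    ultimately have "cnj z ^ j * z ^ n = z ^ (n - j)"
      by (metis mult.assoc mult_1)
    hence "cnj z ^ j * (z ^ n * cnj (poly p z)) = cnj (poly p z) * z ^ (n - j)"
      by (metis mult.assoc mult.commute)
    thus "cnj (poly (monom 1 j) z) * poly (conj_reverse n p) z =
          cnj (poly p z) * poly (monom 1 (n - j)) z"
      by (simp add: poly_conj_reverse_circle[OF assms(1) z] poly_monom)
  qed
qed measurable

lemma monic_orthogonal_conj_reverse:
  assumes "monic_orthogonal n p" "1 \<le> j" "j \<le> n"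
  shows "ip (monom 1 j) (conj_reverse n p) = 0"
  using assms by (subst ip_monom_conj_reverse) (auto simp: monic_orthogonal_def)

lemma norm2_conj_reverse:
  assumes "degree p \<le> n"
  shows "norm2 (conj_reverse n p) = norm2 p"
  unfolding norm2_def
proof (rule integral_cong_AE)
  show "AE z in \<mu>. (cmod (poly (conj_reverse n p) z))\<^sup>2 = (cmod (poly p z))\<^sup>2"
    using AE_circle
    by eventually_elim (simp add: poly_conj_reverse_circle[OF assms] norm_mult norm_power)
qed measurable

lemma norm2_pCons_0: "norm2 (pCons 0 p) = norm2 p"
  unfolding norm2_def
proof (rule integral_cong_AE)
  show "AE z in \<mu>. (cmod (poly (pCons 0 p) z))\<^sup>2 = (cmod (poly p z))\<^sup>2"
    using AE_circle by eventually_elim (simp add: norm_mult)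
qed measurable

lemma ip_monom_Suc_pCons_0: "ip (monom 1 (Suc j)) (pCons 0 p) = ip (monom 1 j) p"
  unfolding ip_def
proof (rule integral_cong_AE)
  show "AE z in \<mu>. cnj (poly (monom 1 (Suc j)) z) * poly (pCons 0 p) z
          = cnj (poly (monom 1 j) z) * poly p z"
    using AE_circle
  proof eventually_elim
    fix z :: complex assume z: "cmod z = 1"
    have "cnj z * z = 1"
      by (rule cnj_mult_self_circle[OF z])
    thus "cnj (poly (monom 1 (Suc j)) z) * poly (pCons 0 p) z = cnj (poly (monom 1 j) z) * poly p z"
      by (simp add: poly_monom)
  qed
qed measurable

text \<open>Existence and recursion come together: z p and the reversal of p are both orthogonal to
  z, ..., z^n, so a multiple of the reversal corrects the one missing relation, with 1. The bound on
  c is Pythagoras for z p = r + c q: the reversal q has the norm of p and is orthogonal to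
  r.\<close>

lemma monic_orthogonal_Suc:
  assumes p: "monic_orthogonal n p"
  obtains c where "monic_orthogonal (Suc n) (pCons 0 p - smult c (conj_reverse n p))" "cmod c < 1"
proof -
  let ?q = "conj_reverse n p"
  have deg: "degree p = n" and lead: "coeff p n = 1" and "p \<noteq> 0"
    using p by (auto simp: monic_orthogonal_def)
  have q0: "coeff ?q 0 = 1"
    by (simp add: coeff_conj_reverse lead)
  \<comment> \<open>The reversal has constant coefficient 1 and is orthogonal to z, ..., z^n; so its
    inner product with 1 is its squared norm, and the denominator of \<open>c\<close> is
    nonzero.\<close>
  have "ip (?q - 1) ?q = 0"
  proof (rule ip_eq_0)
    fix j assume "coeff (?q - 1) j \<noteq> 0"
    hence "1 \<le> j \<and> j \<le> n"
      using q0 by (cases j) (auto simp: coeff_conj_reverse split: if_splits)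
    thus "ip (monom 1 j) ?q = 0"
      using monic_orthogonal_conj_reverse[OF p] by blast
  qed
  hence "ip 1 ?q = norm2 p"
    using norm2_conj_reverse[of p n] deg by (simp add: ip_left ip_self)
  hence ne: "ip 1 ?q \<noteq> 0"
    using norm2_pos[OF \<open>p \<noteq> 0\<close>] by simp
  define c where "c = ip 1 (pCons 0 p) / ip 1 ?q"
  define r where "r = pCons 0 p - smult c ?q"
  have coeff_r: "coeff r (Suc n) = 1" "\<And>j. j > Suc n \<Longrightarrow> coeff r j = 0"
    using deg lead by (auto simp: r_def coeff_pCons coeff_conj_reverse coeff_eq_0 split: nat.splits)
  have deg_r: "degree r = Suc n"
    using coeff_r by (metis degree_le le_antisym le_degree not_le one_neq_zero)
  have orth: "ip (monom 1 j) r = 0" if "j < Suc n" for j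
  proof (cases j)
    case 0
    thus ?thesis
      using ne by (simp add: r_def ip_right c_def)
  next
    case (Suc i)
    thus ?thesis
      using that p monic_orthogonal_conj_reverse[OF p, of j]
      by (auto simp: r_def ip_right ip_monom_Suc_pCons_0 monic_orthogonal_def)
  qed
  have mo: "monic_orthogonal (Suc n) r"
    using deg_r coeff_r orth by (auto simp: monic_orthogonal_def)
  have "ip ?q r = 0"
    by (rule ip_eq_0) (use orth in \<open>auto simp: coeff_conj_reverse split: if_splits\<close>)
  hence "ip r ?q = 0"
    by (metis cnj_ip complex_cnj_zero)
  have "ip (r + smult c ?q) (r + smult c ?q) = ip r r + c * cnj c * ip ?q ?q"
    using \<open>ip ?q r = 0\<close> \<open>ip r ?q = 0\<close> by (simp add: ip_left ip_right)
  also have "r + smult c ?q = pCons 0 p"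
    by (simp add: r_def)
  finally have "complex_of_real (norm2 p) = norm2 r + c * cnj c * norm2 p"
    using norm2_conj_reverse[of p n] deg by (simp add: ip_self norm2_pCons_0)
  hence "complex_of_real (norm2 p) = complex_of_real (norm2 r + (cmod c)\<^sup>2 * norm2 p)"
    by (simp add: complex_norm_square flip: of_real_power)
  hence "norm2 p = norm2 r + (cmod c)\<^sup>2 * norm2 p"
    using of_real_eq_iff by blast
  moreover have "norm2 r > 0"
    using coeff_r by (intro norm2_pos) auto
  ultimately have "(cmod c)\<^sup>2 * norm2 p < 1 * norm2 p" by linarith
  hence "(cmod c)\<^sup>2 < 1\<^sup>2"
    using norm2_pos[OF \<open>p \<noteq> 0\<close>] by simp
  hence "cmod c < 1"
    by (rule power2_less_imp_less) auto
  thus ?thesis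
    using mo that unfolding r_def by blast
qed

lemma ex_monic_orthogonal: "\<exists>p. monic_orthogonal n p"
proof (induction n)
  case 0
  have "monic_orthogonal 0 1" by (simp add: monic_orthogonal_def)
  thus ?case by blast
qed (metis monic_orthogonal_Suc)

section \<open>The orthogonal polynomials of \<open>\<mu>\<close>, their reversals and the
  recursion\<close>

abbreviation \<Phi> :: "nat \<Rightarrow> complex poly" where "\<Phi> \<equiv> monic_opuc \<mu>"

abbreviation \<Phi>r :: "nat \<Rightarrow> complex poly" where "\<Phi>r n \<equiv> conj_reverse n (\<Phi> n)"

abbreviation \<alpha> :: "nat \<Rightarrow> complex" where "\<alpha> \<equiv> verblunsky \<mu>"

lemma monic_orthogonal_opuc: "monic_orthogonal n (\<Phi> n)"
proof -
  obtain p where p: "monic_orthogonal n p"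
    using ex_monic_orthogonal by blast
  have "\<Phi> n = (THE p. monic_orthogonal n p)"
    unfolding monic_opuc_def monic_orthogonal_def ip_def poly_monom by simp
  also have "\<dots> = p"
    using p monic_orthogonal_unique[OF _ p] by (rule the_equality)
  finally have "\<Phi> n = p" .
  thus ?thesis
    using p by (rule ssubst)
qed

lemma degree_opuc [simp]: "degree (\<Phi> n) = n"
  using monic_orthogonal_opuc[of n] unfolding monic_orthogonal_def by (elim conjE)

lemma lead_coeff_opuc [simp]: "coeff (\<Phi> n) n = 1"
  using monic_orthogonal_opuc[of n] unfolding monic_orthogonal_def by (metis (full_types))

lemma opuc_0 [simp]: "\<Phi> 0 = 1"
  by (rule monic_orthogonal_unique[OF monic_orthogonal_opuc]) (simp add: monic_orthogonal_def)

text \<open>The constant c of the construction is identified by evaluating at 0, where z \<Phi>_n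
  vanishes and the reversal equals 1.\<close>

lemma szego_recursion: "\<Phi> (Suc n) = pCons 0 (\<Phi> n) - smult (cnj (\<alpha> n)) (\<Phi>r n)"
  and cmod_verblunsky_less_1: "cmod (\<alpha> n) < 1"
proof -
  obtain c where c: "monic_orthogonal (Suc n) (pCons 0 (\<Phi> n) - smult c (\<Phi>r n))" "cmod c < 1"
    using monic_orthogonal_Suc[OF monic_orthogonal_opuc] by blast
  have eq: "\<Phi> (Suc n) = pCons 0 (\<Phi> n) - smult c (\<Phi>r n)"
    by (rule monic_orthogonal_unique[OF monic_orthogonal_opuc c(1)])
  have "c = cnj (\<alpha> n)"
    by (simp add: verblunsky_def eq poly_0_coeff_0 coeff_conj_reverse)
  thus "\<Phi> (Suc n) = pCons 0 (\<Phi> n) - smult (cnj (\<alpha> n)) (\<Phi>r n)" "cmod (\<alpha> n) < 1"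
    using eq c(2) by auto
qed

lemma szego_recursion_reverse: "\<Phi>r (Suc n) = \<Phi>r n - smult (\<alpha> n) (pCons 0 (\<Phi> n))"
  by (simp add: szego_recursion conj_reverse_diff_smult conj_reverse_pCons conj_reverse_conj_reverse)

end

subsection \<open>Exponentially decaying Verblunsky coefficients\<close>

text \<open>The error bound is the tail of the geometric series that dominates the
  increments.\<close>

lemma geometric_increments_limit:
  fixes f :: "nat \<Rightarrow> complex"
  assumes s: "0 \<le> s" "s < 1" and A: "\<And>n. cmod (f (Suc n) - f n) \<le> A * s ^ n"
  shows "convergent f" "cmod (f n - lim f) \<le> A / (1 - s) * s ^ n"
proof -
  have "summable (\<lambda>n. f (Suc n) - f n)"
    by (rule summable_comparison_test'[of "\<lambda>n. A * s ^ n" 0])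
       (use s A in \<open>auto intro!: summable_mult summable_geometric\<close>)
  hence "(\<lambda>n. \<Sum>i<n. f (Suc i) - f i) \<longlonglongrightarrow> (\<Sum>i. f (Suc i) - f i)"
    by (rule summable_LIMSEQ)
  hence "(\<lambda>n. f n - f 0) \<longlonglongrightarrow> (\<Sum>i. f (Suc i) - f i)"
    by (simp only: sum_lessThan_telescope)
  from tendsto_add[OF this tendsto_const[of "f 0"]]
  show conv: "convergent f"
    by (simp add: convergent_def) blast
  have A0: "0 \<le> A"
    using order_trans[OF norm_ge_zero A[of 0]] by simp
  have bound: "cmod (f n - f (n + k)) \<le> A / (1 - s) * s ^ n" for k
  proof -
    \<comment> \<open>Keeping the exact partial geometric sum lets the induction close.\<close>
    have "cmod (f n - f (n + k)) \<le> A / (1 - s) * (s ^ n - s ^ (n + k))"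
    proof (induction k)
      case (Suc k)
      have "cmod (f n - f (n + Suc k)) \<le> cmod (f n - f (n + k)) + cmod (f (Suc (n + k)) - f (n + k))"
        by (metis add_Suc_right norm_minus_commute norm_diff_triangle_le order_refl)
      also have "\<dots> \<le> A / (1 - s) * (s ^ n - s ^ (n + k)) + A * s ^ (n + k)"
        by (intro add_mono Suc.IH A)
      also have "\<dots> = A / (1 - s) * (s ^ n - s ^ (n + Suc k))"
        using s by (simp add: field_simps)
      finally show ?case .
    qed simp
    also have "\<dots> \<le> A / (1 - s) * s ^ n"
      using A0 s by (intro mult_left_mono) auto
    finally show ?thesis .
  qed
  have "(\<lambda>k. cmod (f n - f (k + n))) \<longlonglongrightarrow> cmod (f n - lim f)"
    using conv unfolding convergent_LIMSEQ_iff
    by (intro tendsto_norm tendsto_diff tendsto_const) (rule LIMSEQ_ignore_initial_segment)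
  thus "cmod (f n - lim f) \<le> A / (1 - s) * s ^ n"
    by (rule LIMSEQ_le_const2) (use bound in \<open>auto simp: add.commute\<close>)
qed

lemma root_test_geometric_bound:
  fixes a :: "nat \<Rightarrow> real"
  assumes lim: "(\<lambda>n. root n (a n)) \<longlonglongrightarrow> b" and a: "\<And>n. 0 \<le> a n" and r: "b < r" "0 < r"
  obtains C where "C > 0" "\<And>n. a n \<le> C * r ^ n"
proof -
  have "\<forall>\<^sub>F n in sequentially. root n (a n) < r"
    using lim r(1) by (rule order_tendstoD)
  then obtain N where N: "\<And>n. n \<ge> N \<Longrightarrow> root n (a n) < r"
    by (auto simp: eventually_sequentially)
  \<comment> \<open>The sum absorbs the finitely many indices up to \<open>N\<close>, among them
    index 0, where \<open>root 0\<close> is 0 by convention and carries no information; the 1 serves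
    the later indices.\<close>
  define C where "C = 1 + (\<Sum>k\<le>N. a k / r ^ k)"
  have nonneg: "0 \<le> a k / r ^ k" for k
    using a r by simp
  have C1: "1 \<le> C"
    by (simp add: C_def sum_nonneg nonneg)
  have "a n \<le> C * r ^ n" for n
  proof (cases "n \<le> N")
    case True
    have "a n / r ^ n \<le> (\<Sum>k\<le>N. a k / r ^ k)"
      using True nonneg by (intro member_le_sum) auto
    hence "a n / r ^ n \<le> C" by (simp add: C_def)
    thus ?thesis using r by (simp add: pos_divide_le_eq)
  next
    case False
    hence "n > 0" "root n (a n) < r" using N by auto
    hence "root n (a n) ^ n \<le> r ^ n"
      using a by (intro power_mono) auto
    hence "a n \<le> 1 * r ^ n"
      using a \<open>n > 0\<close> by simp
    also have "\<dots> \<le> C * r ^ n"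
      using C1 r by (intro mult_right_mono) auto
    finally show ?thesis .
  qed
  thus ?thesis using that C1 by (metis less_le_trans zero_less_one)
qed

lemma open_inverse_disk: "open (inverse_disk b)"
  unfolding inverse_disk_def by (intro open_Collect_less continuous_intros)

lemma connected_inverse_disk:
  assumes "0 \<le> b"
  shows "connected (inverse_disk b)"
proof (cases "b = 0")
  case False
  hence "inverse_disk b = ball 0 (1 / b)"
    using assms by (auto simp: inverse_disk_def field_simps)
  thus ?thesis by simp
qed (simp add: inverse_disk_def connected_UNIV)

text \<open>Phrased by products and not by 1 / b, so that b = 0 is included; the step t is half of
  the gap 1 - b m.\<close>

lemma ex_larger_radius:
  fixes b m :: real
  assumes "0 \<le> b" "b < 1" "b * m < 1"
  obtains R where "m < R" "b * R < 1"
proof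
  define t where "t = (1 - b * m) / 2"
  have t: "b * m = 1 - 2 * t" "0 < t"
    using assms by (auto simp: t_def field_simps)
  show "m < m + t" using t by simp
  have "b * t \<le> t"
    using assms t by (simp add: mult_left_le_one_le)
  thus "b * (m + t) < 1"
    using t by (simp add: distrib_left)
qed

text \<open>The Szego step preserves the form |q|^2 - |w|^2 up to the factor 1 - |a|^2; it is
  applied with q = \<open>\<Phi>r n\<close>, w = z \<Phi>_n and a = \<open>\<alpha> n\<close>, all
  evaluated at a point z.\<close>

lemma schur_identity:
  "(cmod (q - a * w))\<^sup>2 - (cmod (w - cnj a * q))\<^sup>2 = (1 - (cmod a)\<^sup>2) * ((cmod q)\<^sup>2 - (cmod w)\<^sup>2)"
  unfolding cmod_power2 by (simp add: power2_eq_square algebra_simps)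

locale decaying_verblunsky = nontrivial_circle_measure +
  fixes b :: real
  assumes verblunsky_root: "(\<lambda>n. root n (cmod (verblunsky \<mu> n))) \<longlonglongrightarrow> b"
    and b_less_1: "b < 1"
begin

lemma b_nonneg: "0 \<le> b"
  using verblunsky_root by (rule LIMSEQ_le_const) (intro exI allI impI real_root_ge_zero norm_ge_zero)

lemma inverse_disk_radius:
  assumes "z \<in> inverse_disk b"
  obtains R where "1 < R" "cmod z < R" "b * R < 1"
proof -
  have "b * max 1 (cmod z) < 1"
    using assms b_less_1 by (auto simp: inverse_disk_def max_def)
  then obtain R where "max 1 (cmod z) < R" "b * R < 1"
    using ex_larger_radius[OF b_nonneg b_less_1] by blast
  thus ?thesis using that[of R] by simp
qed

lemma cball_subset_inverse_disk:
  assumes "b * R < 1"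
  shows "cball 0 R \<subseteq> inverse_disk b"
proof
  fix z :: complex assume "z \<in> cball 0 R"
  hence "b * cmod z \<le> b * R"
    using b_nonneg by (intro mult_left_mono) auto
  thus "z \<in> inverse_disk b"
    using assms by (simp add: inverse_disk_def)
qed

lemma unit_cball_subset_inverse_disk: "cball 0 1 \<subseteq> inverse_disk b"
  using b_less_1 by (intro cball_subset_inverse_disk) simp

lemma verblunsky_bound:
  assumes "b < r"
  obtains C where "C > 0" "\<And>n. cmod (\<alpha> n) \<le> C * r ^ n"
  using root_test_geometric_bound[OF verblunsky_root] assms b_nonneg by auto

lemma summable_verblunsky: "summable (\<lambda>n. cmod (\<alpha> n))"
proof -
  define r where "r = (b + 1) / 2"
  have r: "b < r" "0 < r" "r < 1"
    using b_less_1 b_nonneg by (auto simp: r_def)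
  obtain C where C: "\<And>n. cmod (\<alpha> n) \<le> C * r ^ n"
    using verblunsky_bound[OF r(1)] by blast
  show ?thesis
    by (rule summable_comparison_test'[of "\<lambda>n. C * r ^ n" 0])
       (use r C in \<open>auto intro!: summable_mult summable_geometric\<close>)
qed

section \<open>Growth bounds for the orthogonal polynomials and their reversals\<close>

lemma opuc_Suc:
  "poly (\<Phi> (Suc n)) z = z * poly (\<Phi> n) z - cnj (\<alpha> n) * poly (\<Phi>r n) z"
  by (simp add: szego_recursion)

lemma opuc_reverse_Suc:
  "poly (\<Phi>r (Suc n)) z = poly (\<Phi>r n) z - \<alpha> n * (z * poly (\<Phi> n) z)"
  by (simp add: szego_recursion_reverse)

lemma poly_opuc_reverse_0: "poly (\<Phi>r n) 0 = 1"
  by (simp add: poly_0_coeff_0 coeff_conj_reverse)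

text \<open>By \<open>schur_identity\<close> the sign of the difference of squared moduli is
  inherited from step to step, as |z| \<le> 1 and |\<alpha>_n| < 1.\<close>

lemma cmod_opuc_le_reverse:
  assumes z: "cmod z \<le> 1"
  shows "cmod (poly (\<Phi> n) z) \<le> cmod (poly (\<Phi>r n) z)"
proof (induction n)
  case 0
  show ?case by simp
next
  case (Suc n)
  have "cmod (z * poly (\<Phi> n) z) \<le> 1 * cmod (poly (\<Phi> n) z)"
    unfolding norm_mult using z by (intro mult_right_mono) auto
  also note Suc
  finally have "(cmod (z * poly (\<Phi> n) z))\<^sup>2 \<le> (cmod (poly (\<Phi>r n) z))\<^sup>2"
    by (simp add: power_mono)
  moreover have "(cmod (\<alpha> n))\<^sup>2 \<le> 1"
    using cmod_verblunsky_less_1[of n] by (simp add: power_le_one)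
  ultimately have "0 \<le> (1 - (cmod (\<alpha> n))\<^sup>2) *
      ((cmod (poly (\<Phi>r n) z))\<^sup>2 - (cmod (z * poly (\<Phi> n) z))\<^sup>2)"
    by simp
  hence "(cmod (poly (\<Phi> (Suc n)) z))\<^sup>2 \<le> (cmod (poly (\<Phi>r (Suc n)) z))\<^sup>2"
    unfolding schur_identity[symmetric] opuc_Suc opuc_reverse_Suc by simp
  thus ?case
    by (rule power2_le_imp_le) simp
qed

lemma cmod_opuc_reverse_increment:
  assumes "cmod z \<le> 1"
  shows "cmod (poly (\<Phi>r (Suc n)) z - poly (\<Phi>r n) z) \<le> cmod (\<alpha> n) * cmod (poly (\<Phi>r n) z)"
proof -
  have "cmod (poly (\<Phi>r (Suc n)) z - poly (\<Phi>r n) z) = cmod (\<alpha> n) * (cmod z * cmod (poly (\<Phi> n) z))"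
    by (simp add: opuc_reverse_Suc norm_mult)
  also have "\<dots> \<le> cmod (\<alpha> n) * (1 * cmod (poly (\<Phi>r n) z))"
    by (intro mult_left_mono mult_mono cmod_opuc_le_reverse assms) auto
  finally show ?thesis by simp
qed

text \<open>Majorant of the product of all 1 + |\<alpha>_n|, the factors by which the reversed
  polynomials can grow on the closed unit disk.\<close>

definition K :: real where "K = exp (\<Sum>n. cmod (\<alpha> n))"

lemma K_pos: "K > 0"
  by (simp add: K_def)

lemma cmod_opuc_reverse_le:
  assumes z: "cmod z \<le> 1"
  shows "cmod (poly (\<Phi>r n) z) \<le> K"
proof -
  have "cmod (poly (\<Phi>r n) z) \<le> exp (\<Sum>k<n. cmod (\<alpha> k))"
  proof (induction n)
    case 0
    show ?case by simp
  next
    case (Suc n)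
    have "cmod (poly (\<Phi>r (Suc n)) z) \<le>
        cmod (poly (\<Phi>r n) z) + cmod (poly (\<Phi>r (Suc n)) z - poly (\<Phi>r n) z)"
      by (metis add.commute diff_add_cancel norm_triangle_ineq)
    also have "\<dots> \<le> cmod (poly (\<Phi>r n) z) * (1 + cmod (\<alpha> n))"
      using cmod_opuc_reverse_increment[OF z, of n] by (simp add: algebra_simps)
    also have "\<dots> \<le> exp (\<Sum>k<n. cmod (\<alpha> k)) * exp (cmod (\<alpha> n))"
      by (intro mult_mono Suc) (auto simp: exp_ge_add_one_self)
    finally show ?case by (simp add: exp_add)
  qed
  also have "\<dots> \<le> K"
    unfolding K_def by (simp add: sum_le_suminf summable_verblunsky)
  finally show ?thesis .
qed

text \<open>Outside the unit disk, |\<Phi>_n(z)| is |z|^n times the modulus of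
  \<open>\<Phi>r n\<close> at the reflected point 1 / cnj z, which lies inside, where
  \<open>K\<close> is a bound.\<close>

lemma cmod_opuc_le:
  assumes R: "1 \<le> R" and z: "cmod z \<le> R"
  shows "cmod (poly (\<Phi> n) z) \<le> K * R ^ n"
proof (cases "cmod z \<le> 1")
  case True
  have "cmod (poly (\<Phi> n) z) \<le> K * 1"
    using cmod_opuc_le_reverse[OF True] cmod_opuc_reverse_le[OF True] by (auto intro: order_trans)
  also have "\<dots> \<le> K * R ^ n"
    using K_pos R by (intro mult_left_mono) auto
  finally show ?thesis .
next
  case False
  hence [simp]: "z \<noteq> 0" by auto
  define u where "u = 1 / cnj z"
  have u: "u \<noteq> 0" "cmod u = 1 / cmod z" "1 / cnj u = z"
    by (simp_all add: u_def norm_divide)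
  have "cmod (poly (\<Phi>r n) u) = cmod (poly (\<Phi> n) z) / cmod z ^ n"
    using u by (subst poly_conj_reverse) (simp_all add: norm_mult norm_power power_one_over)
  moreover have "cmod (poly (\<Phi>r n) u) \<le> K"
    using False by (intro cmod_opuc_reverse_le) (simp add: u(2))
  ultimately have "cmod (poly (\<Phi> n) z) \<le> K * cmod z ^ n"
    by (simp add: divide_le_eq)
  also have "\<dots> \<le> K * R ^ n"
    using K_pos z by (intro mult_left_mono power_mono) auto
  finally show ?thesis .
qed

section \<open>The limit function: holomorphy and absence of zeros on the closed disk\<close>

definition G :: "complex \<Rightarrow> complex" where
  "G z = lim (\<lambda>n. poly (\<Phi>r n) z)"

text \<open>As \<open>lim\<close> is total, \<open>G\<close> is Borel on the whole plane, although
  convergence is established only on \<open>inverse_disk b\<close>; integrands with \<open>G\<close>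
  thus need no cut-off.\<close>

lemma borel_measurable_G [measurable]: "G \<in> borel_measurable borel"
  unfolding G_def by measurable

text \<open>The increment \<alpha>_n z \<Phi>_n pits the decay r^n of the coefficients against the
  growth R^n of the polynomials, which gives the ratio s = r R.\<close>

lemma opuc_reverse_geometric_convergence:
  assumes R: "1 \<le> R" "b * R < 1"
  obtains C s where "0 < C" "0 < s" "s < 1"
    "\<And>z. cmod z \<le> R \<Longrightarrow> (\<lambda>n. poly (\<Phi>r n) z) \<longlonglongrightarrow> G z"
    "\<And>n z. cmod z \<le> R \<Longrightarrow> cmod (poly (\<Phi>r n) z - G z) \<le> C * s ^ n"
proof -
  \<comment> \<open>Midpoint of b and 1 / R: above b, so that it bounds the decay of the
    coefficients, and below 1 / R, so that r R < 1.\<close>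
  define r where "r = (b + 1 / R) / 2"
  have bR: "b < 1 / R"
    using R by (simp add: divide_simps)
  hence r: "b < r" "0 < r" "r < 1 / R"
    using b_nonneg R by (auto simp: r_def)
  obtain A where A: "A > 0" "\<And>n. cmod (\<alpha> n) \<le> A * r ^ n"
    using verblunsky_bound[OF r(1)] by blast
  define s where "s = r * R"
  have s: "0 < s" "s < 1"
    using r R by (auto simp: s_def field_simps)
  have incr: "cmod (poly (\<Phi>r (Suc n)) z - poly (\<Phi>r n) z) \<le> A * K * R * s ^ n"
    if "cmod z \<le> R" for z n
  proof -
    have "cmod (poly (\<Phi>r (Suc n)) z - poly (\<Phi>r n) z) = cmod (\<alpha> n) * (cmod z * cmod (poly (\<Phi> n) z))"
      by (simp add: opuc_reverse_Suc norm_mult)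
    also have "\<dots> \<le> (A * r ^ n) * (R * (K * R ^ n))"
      using A R r K_pos by (intro mult_mono A cmod_opuc_le that) auto
    also have "\<dots> = A * K * R * s ^ n"
      by (simp add: s_def power_mult_distrib)
    finally show ?thesis .
  qed
  show ?thesis
  proof (rule that)
    show "0 < A * K * R / (1 - s)"
      using A K_pos R s by simp
    show "(\<lambda>n. poly (\<Phi>r n) z) \<longlonglongrightarrow> G z" if "cmod z \<le> R" for z
      using geometric_increments_limit(1)[OF less_imp_le[OF s(1)] s(2) incr[OF that]]
      by (simp add: G_def convergent_LIMSEQ_iff)
    show "cmod (poly (\<Phi>r n) z - G z) \<le> A * K * R / (1 - s) * s ^ n" if "cmod z \<le> R" for n z
      using geometric_increments_limit(2)[OF less_imp_le[OF s(1)] s(2) incr[OF that]]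
      by (simp add: G_def)
  qed (use s in auto)
qed

lemma opuc_reverse_tendsto:
  assumes "z \<in> inverse_disk b"
  shows "(\<lambda>n. poly (\<Phi>r n) z) \<longlonglongrightarrow> G z"
proof -
  obtain R where "1 < R" "cmod z < R" "b * R < 1"
    using inverse_disk_radius[OF assms] .
  thus ?thesis
    using opuc_reverse_geometric_convergence[of R] by (metis less_imp_le)
qed

lemma opuc_reverse_tendsto_disk: "cmod z \<le> 1 \<Longrightarrow> (\<lambda>n. poly (\<Phi>r n) z) \<longlonglongrightarrow> G z"
  using unit_cball_subset_inverse_disk by (intro opuc_reverse_tendsto) auto

lemma G_holomorphic: "G holomorphic_on inverse_disk b"
proof (rule holomorphic_uniform_sequence[OF open_inverse_disk])
  show "poly (\<Phi>r n) holomorphic_on inverse_disk b" for n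
    by (intro holomorphic_intros)
next
  fix x assume x: "x \<in> inverse_disk b"
  then obtain R where R: "1 < R" "cmod x < R" "b * R < 1"
    using inverse_disk_radius by blast
  obtain C s where Cs: "0 < s" "s < 1"
    "\<And>n z. cmod z \<le> R \<Longrightarrow> cmod (poly (\<Phi>r n) z - G z) \<le> C * s ^ n"
    using opuc_reverse_geometric_convergence[of R] R by (metis less_imp_le)
  have sub: "cball x (R - cmod x) \<subseteq> cball 0 R"
    by (simp add: cball_subset_cball_iff)
  have "uniform_limit (cball 0 R) (\<lambda>n. poly (\<Phi>r n)) G sequentially"
  proof (rule uniform_limitI)
    fix e :: real assume "e > 0"
    have "(\<lambda>n. C * s ^ n) \<longlonglongrightarrow> C * 0"
      by (intro tendsto_intros LIMSEQ_realpow_zero) (use Cs in auto)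
    hence "\<forall>\<^sub>F n in sequentially. C * s ^ n < e"
      using \<open>e > 0\<close> by (intro order_tendstoD) auto
    thus "\<forall>\<^sub>F n in sequentially. \<forall>z\<in>cball 0 R. dist (poly (\<Phi>r n) z) (G z) < e"
      by eventually_elim (auto simp: dist_norm intro: le_less_trans[OF Cs(3)])
  qed
  hence "uniform_limit (cball x (R - cmod x)) (\<lambda>n. poly (\<Phi>r n)) G sequentially"
    using sub by (rule uniform_limit_on_subset)
  moreover have "cball x (R - cmod x) \<subseteq> inverse_disk b"
    using sub cball_subset_inverse_disk[OF R(3)] by blast
  ultimately show "\<exists>d>0. cball x d \<subseteq> inverse_disk b \<and>
      uniform_limit (cball x d) (\<lambda>n. poly (\<Phi>r n)) G sequentially"
    using R by (intro exI[of _ "R - cmod x"]) auto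
qed

lemma G_0: "G 0 = 1"
  unfolding G_def by (simp add: poly_opuc_reverse_0)

lemma cmod_G_le: "cmod z \<le> 1 \<Longrightarrow> cmod (G z) \<le> K"
  using opuc_reverse_tendsto_disk[of z] cmod_opuc_reverse_le[of z]
  by (intro LIMSEQ_le_const2[OF tendsto_norm]) auto

text \<open>A zero at step n + 1 would make the increment as large as \<open>\<Phi>r n\<close>
  itself, which |\<alpha>_n| < 1 forbids unless that value vanishes too.\<close>

lemma opuc_reverse_nonzero:
  assumes z: "cmod z \<le> 1"
  shows "poly (\<Phi>r n) z \<noteq> 0"
proof (induction n)
  case 0
  show ?case by simp
next
  case (Suc n)
  show ?case
  proof
    assume "poly (\<Phi>r (Suc n)) z = 0"
    hence "cmod (poly (\<Phi>r n) z) \<le> cmod (\<alpha> n) * cmod (poly (\<Phi>r n) z)"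
      using cmod_opuc_reverse_increment[OF z, of n] by simp
    thus False
      using Suc cmod_verblunsky_less_1[of n] by simp
  qed
qed

text \<open>A step lowers the modulus at most by the factor 1 - |\<alpha>_n|. To keep the limit away
  from 0, the count starts at an index m whose tail sum is below 1/2; the product of the factors is
  then at least 1 minus that sum.\<close>

lemma G_nonzero:
  assumes z: "cmod z \<le> 1"
  shows "G z \<noteq> 0"
proof -
  obtain m where "norm (\<Sum>k. cmod (\<alpha> (k + m))) < 1 / 2"
    using suminf_exist_split[OF _ summable_verblunsky, of "1 / 2"] by auto
  hence m: "(\<Sum>k. cmod (\<alpha> (k + m))) < 1 / 2"
    unfolding real_norm_def by linarith
  define c where "c = cmod (poly (\<Phi>r m) z)"
  have c: "c > 0"
    using opuc_reverse_nonzero[OF z] by (simp add: c_def)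
  have tail: "(\<Sum>i<k. cmod (\<alpha> (i + m))) < 1 / 2" for k
    using m sum_le_suminf[of "\<lambda>i. cmod (\<alpha> (i + m))" "{..<k}"]
      summable_ignore_initial_segment[OF summable_verblunsky, of m] by auto
  have "c * (1 - (\<Sum>i<k. cmod (\<alpha> (i + m)))) \<le> cmod (poly (\<Phi>r (k + m)) z)" for k
  proof (induction k)
    case 0
    show ?case by (simp add: c_def)
  next
    case (Suc k)
    let ?S = "\<Sum>i<k. cmod (\<alpha> (i + m))" and ?a = "cmod (\<alpha> (k + m))"
    have S: "0 \<le> ?S" by (simp add: sum_nonneg)
    have "c * (1 - (\<Sum>i<Suc k. cmod (\<alpha> (i + m)))) = c * (1 - ?S - ?a)"
      by simp
    also have "\<dots> \<le> c * ((1 - ?S) * (1 - ?a))"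
      using S c by (intro mult_left_mono) (auto simp: algebra_simps)
    also have "\<dots> \<le> cmod (poly (\<Phi>r (k + m)) z) * (1 - ?a)"
      unfolding mult.assoc[symmetric]
      using cmod_verblunsky_less_1[of "k + m"] by (intro mult_right_mono Suc) auto
    also have "\<dots> \<le> cmod (poly (\<Phi>r (Suc k + m)) z)"
      using cmod_opuc_reverse_increment[OF z, of "k + m"]
        norm_triangle_ineq2[of "poly (\<Phi>r (k + m)) z" "poly (\<Phi>r (Suc (k + m))) z"]
      by (simp add: algebra_simps norm_minus_commute)
    finally show ?case .
  qed
  moreover have "c * (1 / 2) \<le> c * (1 - (\<Sum>i<k. cmod (\<alpha> (i + m))))" for k
    using tail[of k] c by (intro mult_left_mono) auto
  ultimately have "c / 2 \<le> cmod (poly (\<Phi>r (k + m)) z)" for k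
    by (metis (no_types) order_trans times_divide_eq_right mult_1_right)
  moreover have "(\<lambda>k. cmod (poly (\<Phi>r (k + m)) z)) \<longlonglongrightarrow> cmod (G z)"
    by (intro tendsto_norm LIMSEQ_ignore_initial_segment opuc_reverse_tendsto_disk z)
  ultimately have "c / 2 \<le> cmod (G z)"
    by (intro LIMSEQ_le_const) auto
  thus ?thesis using c by auto
qed

subsection \<open>Identification of the limit with the Szego function\<close>

text \<open>For fixed j the integrals with \<open>\<Phi>r n\<close> vanish once n \<ge> j; dominated
  convergence with majorant \<open>K\<close> carries this to the limit.\<close>

lemma integral_cnj_power_G:
  assumes "1 \<le> j"
  shows "(\<integral>z. cnj z ^ j * G z \<partial>\<mu>) = 0"
proof -
  have "(\<lambda>n. \<integral>z. cnj z ^ j * poly (\<Phi>r n) z \<partial>\<mu>) \<longlonglongrightarrow> (\<integral>z. cnj z ^ j * G z \<partial>\<mu>)"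
  proof (rule integral_dominated_convergence[where w = "\<lambda>_. K"])
    show "AE z in \<mu>. (\<lambda>n. cnj z ^ j * poly (\<Phi>r n) z) \<longlonglongrightarrow> cnj z ^ j * G z"
      using AE_circle
      by eventually_elim (intro tendsto_mult tendsto_const opuc_reverse_tendsto_disk, simp)
    show "AE z in \<mu>. norm (cnj z ^ j * poly (\<Phi>r n) z) \<le> K" for n
      using AE_circle
      by eventually_elim (simp add: norm_mult norm_power cmod_opuc_reverse_le)
  qed auto
  moreover have "\<forall>\<^sub>F n in sequentially. (\<integral>z. cnj z ^ j * poly (\<Phi>r n) z \<partial>\<mu>) = 0"
    using eventually_ge_at_top[of j]
  proof eventually_elim
    case (elim n)
    thus ?case
      using monic_orthogonal_conj_reverse[OF monic_orthogonal_opuc assms, of n]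
      by (simp add: ip_def poly_monom)
  qed
  ultimately show ?thesis
    by (rule LIMSEQ_unique[OF _ tendsto_eventually])
qed

text \<open>The limit is taken in one factor at a time: with \<open>G\<close> already in place, its
  conjugate is approximated by conjugates of \<open>\<Phi>r m\<close>, and each resulting term
  integrates \<open>cnj z ^ (i + j) * G z\<close> with i + j \<ge> 1.\<close>

lemma integral_power_cmod_G:
  assumes "1 \<le> j"
  shows "(\<integral>z. z ^ j * complex_of_real ((cmod (G z))\<^sup>2) \<partial>\<mu>) = 0"
proof -
  have int: "integrable \<mu> (\<lambda>z. cnj z ^ i * G z)" for i
    by (rule integrable_bounded_circle[where B = K])
       (auto simp: norm_mult norm_power cmod_G_le)
  have "(\<lambda>m. \<integral>z. cnj z ^ j * G z * cnj (poly (\<Phi>r m) z) \<partial>\<mu>)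
          \<longlonglongrightarrow> (\<integral>z. cnj z ^ j * G z * cnj (G z) \<partial>\<mu>)"
  proof (rule integral_dominated_convergence[where w = "\<lambda>_. K * K"])
    show "AE z in \<mu>. (\<lambda>m. cnj z ^ j * G z * cnj (poly (\<Phi>r m) z)) \<longlonglongrightarrow> cnj z ^ j * G z * cnj (G z)"
      using AE_circle
      by eventually_elim (intro tendsto_mult tendsto_const tendsto_cnj opuc_reverse_tendsto_disk, simp)
    show "AE z in \<mu>. norm (cnj z ^ j * G z * cnj (poly (\<Phi>r m) z)) \<le> K * K" for m
      using AE_circle
      by eventually_elim
         (auto simp: norm_mult norm_power intro!: mult_mono cmod_opuc_reverse_le cmod_G_le less_imp_le[OF K_pos])
  qed auto
  moreover have "(\<integral>z. cnj z ^ j * G z * cnj (poly (\<Phi>r m) z) \<partial>\<mu>) = 0" for m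
  proof -
    let ?q = "\<Phi>r m"
    have "(\<integral>z. cnj z ^ j * G z * cnj (poly ?q z) \<partial>\<mu>) =
            (\<integral>z. (\<Sum>i\<le>degree ?q. cnj (coeff ?q i) * (cnj z ^ (i + j) * G z)) \<partial>\<mu>)"
      by (simp add: poly_altdef sum_distrib_left power_add mult_ac)
    also have "\<dots> = (\<Sum>i\<le>degree ?q. cnj (coeff ?q i) * (\<integral>z. cnj z ^ (i + j) * G z \<partial>\<mu>))"
      by (subst Bochner_Integration.integral_sum) (auto intro: int)
    also have "\<dots> = 0"
      using assms by (intro sum.neutral ballI) (simp add: integral_cnj_power_G)
    finally show ?thesis .
  qed
  ultimately have "(\<integral>z. cnj z ^ j * G z * cnj (G z) \<partial>\<mu>) = 0"
    by (simp add: LIMSEQ_const_iff)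
  moreover have "(\<integral>z. z ^ j * complex_of_real ((cmod (G z))\<^sup>2) \<partial>\<mu>) =
      (\<integral>z. cnj (cnj z ^ j * G z * cnj (G z)) \<partial>\<mu>)"
    by (simp only: complex_norm_square) (simp add: mult_ac)
  ultimately show ?thesis
    by (simp only: Bochner_Integration.integral_cnj complex_cnj_zero)
qed

text \<open>Total mass of |G|^2 d\<mu>. As G(0) = 1, it turns out to be D(0)^2, so its square root
  is the factor between \<open>G\<close> and 1/D.\<close>

definition \<kappa> :: real where "\<kappa> = (\<integral>z. (cmod (G z))\<^sup>2 \<partial>\<mu>)"

lemma integrable_cmod_G: "integrable \<mu> (\<lambda>z. (cmod (G z))\<^sup>2)"
  by (rule integrable_bounded_circle[where B = "K\<^sup>2"]) (auto intro!: power_mono cmod_G_le)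

lemma \<kappa>_pos: "\<kappa> > 0"
proof -
  have "\<kappa> \<noteq> 0"
  proof
    assume "\<kappa> = 0"
    hence "AE z in \<mu>. (cmod (G z))\<^sup>2 = 0"
      using integral_nonneg_eq_0_iff_AE[OF integrable_cmod_G] by (simp add: \<kappa>_def)
    hence "AE z in \<mu>. z \<in> {}"
      using AE_circle by eventually_elim (simp add: G_nonzero)
    thus False
      using not_AE_finite[of "{}"] by blast
  qed
  moreover have "\<kappa> \<ge> 0"
    by (simp add: \<kappa>_def)
  ultimately show ?thesis by linarith
qed

text \<open>Equal moments give \<open>M = N\<close>; it remains to divide by |G|^2, which is
  positive on the circle and hence almost everywhere.\<close>

lemma \<mu>_eq_distr:
  "\<mu> = distr (density normalized_dtheta (\<lambda>\<theta>. ennreal (\<kappa> / (cmod (G (cis \<theta>)))\<^sup>2))) borel cis"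
proof -
  interpret nd: prob_space normalized_dtheta by (rule prob_space_normalized_dtheta)
  define g where "g = (\<lambda>z. (cmod (G z))\<^sup>2)"
  have [measurable]: "g \<in> borel_measurable borel"
    by (simp add: g_def)
  have g_pos: "g z > 0" if "cmod z = 1" for z
    using G_nonzero[of z] that by (simp add: g_def)
  define L where "L = distr normalized_dtheta borel cis"
  have sets_L [measurable_cong, simp]: "sets L = sets borel"
    by (simp add: L_def)
  define M where "M = density \<mu> (\<lambda>z. ennreal (g z))"
  define N where "N = density L (\<lambda>_. ennreal \<kappa>)"
  have AE_L: "AE z in L. cmod z = 1"
    unfolding L_def by (subst AE_distr_iff) auto
  have "circle_measure M"
  proof (intro circle_measure.intro circle_measure_axioms.intro finite_measureI)
    have "emeasure M (space M) = ennreal (\<integral>z. g z \<partial>\<mu>)"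
      unfolding M_def by (simp add: emeasure_density nn_integral_eq_integral integrable_cmod_G g_def)
    thus "emeasure M (space M) \<noteq> \<infinity>" by simp
    show "sets M = sets borel" by (simp add: M_def)
    show "AE z in M. cmod z = 1"
      unfolding M_def by (subst AE_density) (use AE_circle in auto)
  qed
  moreover have "circle_measure N"
  proof (intro circle_measure.intro circle_measure_axioms.intro finite_measureI)
    have "emeasure L UNIV = 1"
      unfolding L_def using nd.emeasure_space_1 by (subst emeasure_distr) auto
    thus "emeasure N (space N) \<noteq> \<infinity>"
      unfolding N_def by (simp add: emeasure_density L_def)
    show "sets N = sets borel" by (simp add: N_def)
    show "AE z in N. cmod z = 1"
      unfolding N_def by (subst AE_density) (use AE_L in auto)
  qed
  moreover have "(\<integral>z. z ^ k \<partial>M) = (\<integral>z. z ^ k \<partial>N)" for k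
  proof -
    have "(\<integral>z. z ^ k \<partial>M) = (\<integral>z. g z *\<^sub>R z ^ k \<partial>\<mu>)"
      unfolding M_def by (subst integral_density) (auto simp: g_def)
    also have "\<dots> = (\<integral>z. z ^ k * complex_of_real (g z) \<partial>\<mu>)"
      by (simp add: scaleR_conv_of_real mult.commute)
    also have "\<dots> = (if k = 0 then complex_of_real \<kappa> else 0)"
    proof (cases "k = 0")
      case True
      thus ?thesis
        unfolding \<kappa>_def g_def
        by (simp only: simp_thms if_True power_0 mult_1 integral_complex_of_real)
    next
      case False
      thus ?thesis
        unfolding g_def by (subst integral_power_cmod_G) auto
    qed
    also have "\<dots> = complex_of_real \<kappa> * (\<integral>\<theta>. cis \<theta> ^ k \<partial>normalized_dtheta)"
    proof -
      have "(LBINT \<theta>:{0..<2 * pi}. cis \<theta> ^ k) = complex_of_real (2 * pi) * 0 ^ k"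
        by (rule set_integral_mean_value_circle[of "\<lambda>z. z ^ k"]) (intro holomorphic_intros)
      thus ?thesis
        by (subst integral_normalized_dtheta) (auto simp: power_0_left)
    qed
    also have "(\<integral>\<theta>. cis \<theta> ^ k \<partial>normalized_dtheta) = (\<integral>z. z ^ k \<partial>L)"
      unfolding L_def by (rule integral_distr[symmetric]) measurable
    also have "complex_of_real \<kappa> * (\<integral>z. z ^ k \<partial>L) = (\<integral>z. \<kappa> *\<^sub>R z ^ k \<partial>L)"
      by (simp add: scaleR_conv_of_real)
    also have "\<dots> = (\<integral>z. z ^ k \<partial>N)"
      unfolding N_def using \<kappa>_pos by (subst integral_density) auto
    finally show ?thesis .
  qed
  ultimately have MN: "M = N"
    by (rule circle_measure_eqI)
  have "\<mu> = density \<mu> (\<lambda>_. 1)"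
    by (simp add: density_1)
  also have "\<dots> = density \<mu> (\<lambda>z. ennreal (g z) * ennreal (1 / g z))"
  proof (rule density_cong)
    show "AE z in \<mu>. 1 = ennreal (g z) * ennreal (1 / g z)"
      using AE_circle
    proof eventually_elim
      case (elim z)
      hence "g z > 0" by (rule g_pos)
      thus ?case by (simp flip: ennreal_mult)
    qed
  qed auto
  also have "\<dots> = density M (\<lambda>z. ennreal (1 / g z))"
    unfolding M_def by (rule density_density_eq[symmetric]) auto
  also have "\<dots> = density L (\<lambda>z. ennreal \<kappa> * ennreal (1 / g z))"
    unfolding MN N_def by (rule density_density_eq) auto
  also have "\<dots> = density L (\<lambda>z. ennreal (\<kappa> / g z))"
    using \<kappa>_pos by (intro density_cong AE_I2) (auto simp: g_def simp flip: ennreal_mult)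
  also have "\<dots> = distr (density normalized_dtheta (\<lambda>\<theta>. ennreal (\<kappa> / g (cis \<theta>)))) borel cis"
    unfolding L_def by (subst density_distr) auto
  finally show ?thesis by (simp add: g_def)
qed

lemma AE_weight:
  assumes "circle_lebesgue_decomposition \<mu> w \<mu>s"
  shows "AE \<theta> in normalized_dtheta. w \<theta> = \<kappa> / (cmod (G (cis \<theta>)))\<^sup>2"
  using \<kappa>_pos by (intro circle_lebesgue_decomposition_density[OF assms _ _ \<mu>_eq_distr]) auto

text \<open>The candidate for log D is a function h with exp h = sqrt \<kappa> / G: then 2 Re h is
  the logarithm of \<kappa> / |G|^2, which is the weight almost everywhere.\<close>

lemma szego_function_eq:
  assumes dec: "circle_lebesgue_decomposition \<mu> w \<mu>s" and z: "cmod z < 1"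
  shows "szego_function w z = sqrt \<kappa> / G z"
proof -
  \<comment> \<open>A logarithm of \<open>G\<close> is wanted on an open disk containing the closed
    unit disk; compactness gives the extra room \<open>e\<close>.\<close>
  have "open (inverse_disk b \<inter> G -` (- {0}))"
    using holomorphic_on_imp_continuous_on[OF G_holomorphic] open_inverse_disk
    by (intro continuous_open_preimage) auto
  moreover have "cball 0 1 \<subseteq> inverse_disk b \<inter> G -` (- {0})"
    using unit_cball_subset_inverse_disk G_nonzero by auto
  ultimately obtain e where e: "e > 0"
      "(\<Union>x\<in>cball 0 1. ball x e) \<subseteq> inverse_disk b \<inter> G -` (- {0})"
    using compact_subset_open_imp_ball_epsilon_subset[OF compact_cball] by blast
  have sub: "x \<in> inverse_disk b \<and> G x \<noteq> 0" if x: "x \<in> ball 0 (1 + e)" for x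
  proof (cases "cmod x \<le> 1")
    case True
    thus ?thesis using unit_cball_subset_inverse_disk G_nonzero by auto
  next
    case False
    hence [simp]: "x \<noteq> 0" by auto
    \<comment> \<open>The radial projection of x onto the circle, at distance |x| - 1 < e from
      x.\<close>
    define y where "y = x /\<^sub>R cmod x"
    have "y \<in> cball 0 1"
      by (simp add: y_def)
    moreover have "x - y = (1 - 1 / cmod x) *\<^sub>R x"
      using False by (simp add: y_def scaleR_diff_left divide_inverse)
    hence "dist y x = (1 - 1 / cmod x) * cmod x"
      using False by (simp add: dist_norm norm_minus_commute)
    hence "dist y x = cmod x - 1"
      by (simp add: left_diff_distrib)
    hence "x \<in> ball y e"
      using x by simp
    ultimately show ?thesis using e(2) by blast
  qed
  have "G holomorphic_on ball 0 (1 + e)"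
    using sub by (intro holomorphic_on_subset[OF G_holomorphic]) auto
  then obtain l where l: "l holomorphic_on ball 0 (1 + e)" "\<And>x. x \<in> ball 0 (1 + e) \<Longrightarrow> exp (l x) = G x"
    using holomorphic_logarithm_exists[of "ball 0 (1 + e)" G 0] sub e(1) by auto
  \<comment> \<open>Since G(0) = 1, \<open>l 0\<close> is a multiple of 2 pi i; subtracting it
    leaves the exponential unchanged and makes h(0) real, as the Schwarz formula requires.\<close>
  define h where "h x = complex_of_real (ln \<kappa> / 2) - (l x - l 0)" for x
  have in_ball: "x \<in> ball 0 (1 + e)" if "cmod x \<le> 1" for x :: complex
    using that e(1) by auto
  have exp_h: "exp (h x) = sqrt \<kappa> / G x" if "cmod x \<le> 1" for x
  proof -
    have "exp (ln \<kappa> / 2) = exp (ln (sqrt \<kappa>))"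
      using \<kappa>_pos by (subst ln_sqrt) auto
    also have "\<dots> = sqrt \<kappa>"
      using \<kappa>_pos by (intro exp_ln) simp
    finally have "exp (complex_of_real (ln \<kappa> / 2)) = sqrt \<kappa>"
      by (simp only: exp_of_real)
    moreover have "exp (l 0) = 1"
      using l(2)[of 0] e(1) by (simp add: G_0)
    ultimately show ?thesis
      using l(2)[OF in_ball[OF that]] \<kappa>_pos by (simp add: h_def exp_diff)
  qed
  have holo: "h holomorphic_on cball 0 1"
    unfolding h_def by (intro holomorphic_intros holomorphic_on_subset[OF l(1)]) (use in_ball in auto)
  have h_0: "Im (h 0) = 0"
    by (simp add: h_def)
  have Re_h: "2 * Re (h x) = ln (\<kappa> / (cmod (G x))\<^sup>2)" if "cmod x \<le> 1" for x
  proof -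
    have "exp (Re (h x)) = sqrt \<kappa> / cmod (G x)"
      using exp_h[OF that] \<kappa>_pos by (metis norm_divide norm_exp_eq_Re norm_of_real abs_of_nonneg
          real_sqrt_ge_zero less_imp_le)
    hence "exp (Re (h x)) ^ 2 = \<kappa> / (cmod (G x))\<^sup>2"
      using \<kappa>_pos by (simp add: power_divide)
    hence "exp (2 * Re (h x)) = \<kappa> / (cmod (G x))\<^sup>2"
      by (simp add: exp_double)
    thus ?thesis by (metis ln_exp)
  qed
  have [measurable]: "w \<in> borel_measurable borel"
    using dec by (simp add: circle_lebesgue_decomposition_def)
  have "(LBINT \<theta>:{0..<2 * pi}. (cis \<theta> + z) / (cis \<theta> - z) * complex_of_real (ln (w \<theta>))) =
        (LBINT \<theta>:{0..<2 * pi}. (cis \<theta> + z) / (cis \<theta> - z) *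
            complex_of_real (ln (\<kappa> / (cmod (G (cis \<theta>)))\<^sup>2)))"
  proof (rule set_lebesgue_integral_cong_AE)
    have "AE \<theta> in lborel. \<theta> \<in> {0..<2 * pi} \<longrightarrow> w \<theta> = \<kappa> / (cmod (G (cis \<theta>)))\<^sup>2"
      using AE_weight[OF dec] by (subst (asm) AE_normalized_dtheta_iff) measurable
    thus "AE \<theta>\<in>{0..<2 * pi} in lborel. (cis \<theta> + z) / (cis \<theta> - z) * complex_of_real (ln (w \<theta>)) =
        (cis \<theta> + z) / (cis \<theta> - z) * complex_of_real (ln (\<kappa> / (cmod (G (cis \<theta>)))\<^sup>2))"
      by eventually_elim simp
  qed measurable
  also have "\<dots> = 4 * pi * h z"
    using set_integral_schwarz_circle[OF holo z h_0] by (simp add: Re_h)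
  finally have "szego_function w z = exp (h z)"
    by (simp add: szego_function_def)
  thus ?thesis
    using exp_h[of z] z by simp
qed

text \<open>The continuation is a choice, so G / sqrt \<kappa> has two roles: it shows that a
  continuation exists, and the identity theorem forces the chosen one to equal it.\<close>

lemma szego_inverse_eq:
  assumes dec: "circle_lebesgue_decomposition \<mu> w \<mu>s" and z: "z \<in> inverse_disk b"
  shows "szego_inverse w b z = G z / sqrt \<kappa>"
proof -
  define F where "F = szego_inverse w b"
  have "\<exists>F. F holomorphic_on inverse_disk b \<and> (\<forall>z\<in>ball 0 1. F z = 1 / szego_function w z)"
    by (rule exI[of _ "\<lambda>z. G z / sqrt \<kappa>"])
       (use \<kappa>_pos in \<open>auto intro!: holomorphic_intros G_holomorphic simp: szego_function_eq[OF dec]\<close>)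
  hence "F holomorphic_on inverse_disk b \<and> (\<forall>z\<in>ball 0 1. F z = 1 / szego_function w z)"
    unfolding F_def szego_inverse_def by (rule someI_ex)
  hence F: "F holomorphic_on inverse_disk b" "\<And>z. z \<in> ball 0 1 \<Longrightarrow> F z = 1 / szego_function w z"
    by blast+
  have "F z = G z / sqrt \<kappa>"
  proof (rule analytic_continuation_open[of "ball 0 1" "inverse_disk b" F "\<lambda>z. G z / sqrt \<kappa>"])
    show "ball 0 1 \<subseteq> inverse_disk b"
      using unit_cball_subset_inverse_disk ball_subset_cball by blast
    show "(\<lambda>z. G z / sqrt \<kappa>) holomorphic_on inverse_disk b"
      using \<kappa>_pos by (intro holomorphic_intros G_holomorphic) auto
    show "F z = G z / sqrt \<kappa>" if "z \<in> ball 0 1" for z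
      using that by (simp add: F(2) szego_function_eq[OF dec])
  qed (use F z open_inverse_disk connected_inverse_disk[OF b_nonneg] in auto)
  thus ?thesis by (simp add: F_def)
qed

end

subsection \<open>Convergence of the zeros\<close>

lemma exponential_bound_of_power_bound:
  fixes a :: "nat \<Rightarrow> real"
  assumes "\<forall>\<^sub>F n in sequentially. a n ^ k \<le> C * s ^ n" and k: "0 < k" and s: "0 < s" "s < 1"
    and a: "\<And>n. 0 \<le> a n"
  shows "\<exists>\<epsilon>>0. \<forall>\<^sub>F n in sequentially. a n \<le> exp (- \<epsilon> * real n)"
proof -
  \<comment> \<open>A ratio strictly between s and 1: the factor (s / t)^n absorbs the constant
    \<open>C\<close> for large n.\<close>
  define t where "t = (s + 1) / 2"
  have t: "s < t" "0 < t" "t < 1"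
    using s by (auto simp: t_def)
  \<comment> \<open>Chosen so that t^n is the k-th power of
    \<open>exp (- \<epsilon> * real n)\<close>.\<close>
  define \<epsilon> where "\<epsilon> = - ln t / k"
  have "(\<lambda>n. C * (s / t) ^ n) \<longlonglongrightarrow> C * 0"
    by (intro tendsto_mult tendsto_const LIMSEQ_realpow_zero) (use s t in auto)
  hence "\<forall>\<^sub>F n in sequentially. C * (s / t) ^ n < 1"
    by (intro order_tendstoD) auto
  with assms(1) have "\<forall>\<^sub>F n in sequentially. a n \<le> exp (- \<epsilon> * real n)"
  proof eventually_elim
    case (elim n)
    have "C * s ^ n \<le> t ^ n"
      using elim(2) t by (simp add: power_divide divide_simps)
    also have "t ^ n = exp (real n * ln t)"
      using t by (simp add: exp_of_nat_mult)
    also have "real n * ln t = real k * (- \<epsilon> * real n)"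
      using k by (simp add: \<epsilon>_def)
    also have "exp \<dots> = exp (- \<epsilon> * real n) ^ k"
      by (rule exp_of_nat_mult)
    finally have "a n ^ k \<le> exp (- \<epsilon> * real n) ^ k"
      using elim(1) by linarith
    thus ?case
      using k by (subst (asm) power_mono_iff) (use a in auto)
  qed
  moreover have "\<epsilon> > 0"
    using t k by (simp add: \<epsilon>_def divide_neg_pos)
  ultimately show ?thesis by blast
qed

theorem theorem4p4:
  fixes \<mu> \<mu>s :: "complex measure" and w :: "real \<Rightarrow> real" and b :: real
    and z0 :: complex and z :: "nat \<Rightarrow> complex"
  assumes "nontrivial_circle_prob \<mu>"
    and "circle_lebesgue_decomposition \<mu> w \<mu>s"
    and "(\<lambda>n. root n (cmod (verblunsky \<mu> n))) \<longlonglongrightarrow> b"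
    and "b < 1"
    and "cmod z0 > b"
    and "szego_inverse w b (1 / cnj z0) = 0"
    and "\<forall>\<^sub>F n in sequentially. poly (orthonormal_opuc \<mu> n) (z n) = 0"
    and "z \<longlonglongrightarrow> z0"
  shows "\<exists>\<epsilon>>0. \<forall>\<^sub>F n in sequentially. cmod (z n - z0) \<le> exp (- \<epsilon> * real n)"
proof -
  interpret decaying_verblunsky \<mu> b
    using assms by unfold_locales auto
  have z0: "z0 \<noteq> 0"
    using assms(5) b_nonneg by auto
  define u where "u = 1 / cnj z0"
  have u: "u \<in> inverse_disk b"
    using assms(5) z0 by (simp add: inverse_disk_def u_def norm_divide)
  have "G u = 0"
    using assms(6) szego_inverse_eq[OF assms(2) u] \<kappa>_pos by (simp add: u_def)
  have "0 \<in> inverse_disk b"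
    by (simp add: inverse_disk_def)
  hence "\<not> G constant_on inverse_disk b"
    using \<open>G u = 0\<close> G_0 u unfolding constant_on_def by (metis zero_neq_one)
  then obtain g r k where g: "0 < k" "0 < r" "g holomorphic_on ball u r"
      "\<And>x. x \<in> ball u r \<Longrightarrow> G x = (x - u) ^ k * g x" "\<And>x. x \<in> ball u r \<Longrightarrow> g x \<noteq> 0"
    using holomorphic_factor_zero_nonconstant[OF G_holomorphic open_inverse_disk
        connected_inverse_disk[OF b_nonneg] u \<open>G u = 0\<close>] by metis
  \<comment> \<open>The zero-free factor \<open>g\<close> has a positive minimum \<open>c\<close> of
    its modulus on the compact ball of half the radius, so |G(x)| \<ge> c |x - u|^k there.\<close>
  have "continuous_on (cball u (r / 2)) (\<lambda>x. cmod (g x))"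
    by (intro continuous_on_norm holomorphic_on_imp_continuous_on holomorphic_on_subset[OF g(3)])
       (use g(2) in auto)
  then obtain y where y: "y \<in> cball u (r / 2)" "\<And>x. x \<in> cball u (r / 2) \<Longrightarrow> cmod (g y) \<le> cmod (g x)"
    using continuous_attains_inf[of "cball u (r / 2)" "\<lambda>x. cmod (g x)"] g(2) by auto
  define c where "c = cmod (g y)"
  have c: "c > 0"
    using g(2,5) y(1) by (simp add: c_def)
  obtain R where R: "1 < R" "cmod u < R" "b * R < 1"
    using inverse_disk_radius[OF u] .
  obtain C s where Cs: "0 < C" "0 < s" "s < 1"
      "\<And>n x. cmod x \<le> R \<Longrightarrow> cmod (poly (\<Phi>r n) x - G x) \<le> C * s ^ n"
    using opuc_reverse_geometric_convergence[of R] R by (metis less_imp_le)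
  define v where "v n = 1 / cnj (z n)" for n
  have v: "v \<longlonglongrightarrow> u"
    unfolding v_def u_def using z0 assms(8) by (intro tendsto_intros) auto
  \<comment> \<open>Bounds |z_n z_0| for large n, the factor in z_n - z_0 = - z_n z_0 cnj(v_n -
    u).\<close>
  define B where "B = (cmod z0 + 1) * cmod z0"
  have "\<forall>\<^sub>F n in sequentially. z n \<noteq> 0"
    using tendsto_imp_eventually_ne[OF assms(8) z0] .
  moreover have "\<forall>\<^sub>F n in sequentially. cmod (z n) < cmod z0 + 1"
    using tendsto_norm[OF assms(8)] by (rule order_tendstoD) simp
  moreover have "\<forall>\<^sub>F n in sequentially. dist (v n) u < r / 2"
    using v g(2) by (intro tendstoD) auto
  moreover have "\<forall>\<^sub>F n in sequentially. cmod (v n) < R"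
    using tendsto_norm[OF v] R(2) by (rule order_tendstoD)
  ultimately have "\<forall>\<^sub>F n in sequentially. cmod (z n - z0) ^ k \<le> (B ^ k * C / c) * s ^ n"
    using assms(7)
  proof eventually_elim
    case (elim n)
    \<comment> \<open>The normalizing factor is nonzero, so a zero of
      \<open>orthonormal_opuc \<mu> n\<close> is a zero of \<open>\<Phi> n\<close>.\<close>
    have "norm2 (\<Phi> n) > 0"
      by (rule norm2_pos) (metis lead_coeff_opuc coeff_0 zero_neq_one)
    hence "poly (\<Phi> n) (z n) = 0"
      using elim(5) by (simp add: orthonormal_opuc_def norm2_def)
    hence "poly (\<Phi>r n) (v n) = 0"
      using elim(1) by (subst poly_conj_reverse) (auto simp: v_def)
    hence "cmod (G (v n)) \<le> C * s ^ n"
      using Cs(4)[of "v n" n] elim(4) by simp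
    moreover have "cmod (G (v n)) = cmod (v n - u) ^ k * cmod (g (v n))"
      using g(2) elim(3) by (subst g(4)) (auto simp: norm_mult norm_power dist_commute)
    moreover have "cmod (v n - u) ^ k * c \<le> cmod (v n - u) ^ k * cmod (g (v n))"
      unfolding c_def using elim(3) by (intro mult_left_mono y(2)) (auto simp: dist_commute)
    ultimately have *: "cmod (v n - u) ^ k \<le> C / c * s ^ n"
      using c by (simp add: field_simps)
    have "z n - z0 = - (z n * z0 * cnj (v n - u))"
      using elim(1) z0 by (simp add: v_def u_def field_simps)
    hence "cmod (z n - z0) = cmod (z n) * cmod z0 * cmod (v n - u)"
      by (metis norm_minus_cancel norm_mult complex_mod_cnj)
    also have "\<dots> \<le> B * cmod (v n - u)"
      unfolding B_def using elim(2) by (intro mult_right_mono) auto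
    finally have "cmod (z n - z0) ^ k \<le> (B * cmod (v n - u)) ^ k"
      by (intro power_mono) auto
    also have "\<dots> \<le> B ^ k * (C / c * s ^ n)"
      unfolding power_mult_distrib by (intro mult_left_mono *) (simp add: B_def)
    finally show ?case by simp
  qed
  thus ?thesis
    by (rule exponential_bound_of_power_bound[OF _ g(1) Cs(2,3)]) simp
qed

end
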